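(* Let $\Omega\subset\mathbb{R}^d$ be a non-empty, bounded, open set and let $\Phi\colon\mathbb{R}^N_+\to[0,\infty)$ satisfy (Φ.1), (Φ.2) and (Φ.3). Then there exists a $\Phi$-Cheeger $N$-cluster of $\Omega$, i.e. an $N$-cluster attaining $H^{\Phi,N}(\Omega)$. Consequently (combined with the equality $\mathscr{L}^{\Phi,N}_{1,1}(\Omega)=H^{\Phi,N}(\Omega)$) there also exists a $(1,\Phi)$-eigen-$N$-cluster of $\Omega$.
   Context: All sets are Lebesgue measurable; $|E|$ is Lebesgue measure and $P(E)$ the distributional perimeter; inclusions/disjointness are up to null sets. For $F\subset\mathbb{R}^d$, $h(F)=\inf\{P(E)/|E| : E\subset F,\ |E|>0\}$. An $N$-set of $F$ is an $N$-tuple $\mathcal E=(\mathcal E_1,\dots,\mathcal E_N)$ with $\mathcal E_i\subset F$, $|\mathcal E_i|>0$, $|\mathcal E_i\cap\mathcal E_j|=0$ for $i\ne j$; an $N$-cluster if moreover $P(\mathcal E_i)<\infty$. $\mathbb{R}^N_+=\{v\in\mathbb{R}^N:v_i\ge0\}$ with componentwise order. (Φ.1): $\Phi$ lower semicontinuous. (Φ.2): there is $\delta>0$ with $\Phi(v)\ge\delta\sum_i v_i$ for all $v$. (Φ.3): $v\le w\Rightarrow\Phi(v)\le\Phi(w)$. $H^{\Phi,N}(F)=\inf\{\Phi(P(\mathcal E_1)/|\mathcal E_1|,\dots,P(\mathcal E_N)/|\mathcal E_N|) : \mathcal E \text{ an } N\text{-cluster of } F\}$, minimizers: $\Phi$-Cheeger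 $N$-clusters. $\mathscr{L}^{\Phi,N}_{1,1}(F)=\inf\{\Phi(h(\mathcal E_1),\dots,h(\mathcal E_N)) : \mathcal E \text{ an } N\text{-set of } F\}$; a minimizer that is an $N$-cluster is a $(1,\Phi)$-eigen-$N$-cluster. *)

theory Defs
  imports "HOL-Analysis.Analysis"
begin

definition lsc_on :: "'a::topological_space set \<Rightarrow> ('a \<Rightarrow> real) \<Rightarrow> bool" where
  "lsc_on S f \<longleftrightarrow>
     (\<forall>x\<in>S. \<forall>t. t < f x \<longrightarrow> (\<exists>U. open U \<and> x \<in> U \<and> (\<forall>y\<in>U \<inter> S. t < f y)))"

definition divergence :: "('a::euclidean_space \<Rightarrow> 'a) \<Rightarrow> 'a \<Rightarrow> real" where
  "divergence \<phi> x = (\<Sum>b\<in>Basis. frechet_derivative \<phi> (at x) b \<bullet> b)"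

definition test_fields :: "('a::euclidean_space \<Rightarrow> 'a) set" where
  "test_fields = {\<phi>. (\<forall>x. \<phi> differentiable (at x))
       \<and> (\<forall>b\<in>Basis. continuous_on UNIV (\<lambda>x. frechet_derivative \<phi> (at x) b))
       \<and> compact (closure {x. \<phi> x \<noteq> 0})
       \<and> (\<forall>x. norm (\<phi> x) \<le> 1)}"

definition perimeter :: "'a::euclidean_space set \<Rightarrow> ereal" where
  "perimeter E = (SUP \<phi>\<in>test_fields. ereal (LINT x:E|lebesgue. divergence \<phi> x))"

abbreviation vol :: "'a::euclidean_space set \<Rightarrow> real" where
  "vol E \<equiv> measure lebesgue E"

definition ae_subset :: "'a::euclidean_space set \<Rightarrow> 'a set \<Rightarrow> bool" where
  "ae_subset E F \<longleftrightarrow> E - F \<in> null_sets lebesgue"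

definition cheeger_const :: "'a::euclidean_space set \<Rightarrow> ereal" where
  "cheeger_const F = (INF E\<in>{E. E \<in> sets lebesgue \<and> ae_subset E F \<and> vol E > 0}.
                         perimeter E / ereal (vol E))"

definition is_Nset :: "'a::euclidean_space set \<Rightarrow> ('n \<Rightarrow> 'a set) \<Rightarrow> bool" where
  "is_Nset F \<E> \<longleftrightarrow>
     (\<forall>i. \<E> i \<in> sets lebesgue \<and> ae_subset (\<E> i) F \<and> vol (\<E> i) > 0)
     \<and> (\<forall>i j. i \<noteq> j \<longrightarrow> \<E> i \<inter> \<E> j \<in> null_sets lebesgue)"

definition is_Ncluster :: "'a::euclidean_space set \<Rightarrow> ('n \<Rightarrow> 'a set) \<Rightarrow> bool" where
  "is_Ncluster F \<E> \<longleftrightarrow> is_Nset F \<E> \<and> (\<forall>i. perimeter (\<E> i) < \<infinity>)"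

text \<open>Objective for H: Phi(P(E_1)/|E_1|, ..., P(E_N)/|E_N|) (finite for clusters).\<close>
definition H_value :: "(real^'n \<Rightarrow> real) \<Rightarrow> ('n::finite \<Rightarrow> 'a::euclidean_space set) \<Rightarrow> real" where
  "H_value \<Phi> \<E> = \<Phi> (\<chi> i. real_of_ereal (perimeter (\<E> i)) / vol (\<E> i))"

definition H_const :: "(real^'n \<Rightarrow> real) \<Rightarrow> 'a::euclidean_space set \<Rightarrow> ereal" where
  "H_const \<Phi> F = (INF \<E>\<in>{\<E> :: 'n::finite \<Rightarrow> 'a set. is_Ncluster F \<E>}. ereal (H_value \<Phi> \<E>))"

text \<open>Objective for L_{1,1}: Phi(h(E_1), ..., h(E_N)); taken to be +infinity if some
  h(E_i) is infinite (Phi is only defined on the finite orthant).\<close>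
definition L_value :: "(real^'n \<Rightarrow> real) \<Rightarrow> ('n::finite \<Rightarrow> 'a::euclidean_space set) \<Rightarrow> ereal" where
  "L_value \<Phi> \<E> = (if \<forall>i. cheeger_const (\<E> i) < \<infinity>
                     then ereal (\<Phi> (\<chi> i. real_of_ereal (cheeger_const (\<E> i))))
                     else \<infinity>)"

definition L_const :: "(real^'n \<Rightarrow> real) \<Rightarrow> 'a::euclidean_space set \<Rightarrow> ereal" where
  "L_const \<Phi> F = (INF \<E>\<in>{\<E> :: 'n::finite \<Rightarrow> 'a set. is_Nset F \<E>}. L_value \<Phi> \<E>)"

definition nonneg_orthant :: "(real^'n) set" where
  "nonneg_orthant = {v. \<forall>i. 0 \<le> v $ i}"

end

(* Everything rests on one estimate. Differentiating t |-> int_E psi(x + t h) dx for a C^1 function psi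
   with compact support produces the integral over E of the divergence of a test field, so the mean value
   theorem gives |{x in E. x + h notin E}| <= |h| P(E). Averaging over |h| < r (Tonelli) yields

     int_E |B(x,r) - E| dx <= r P(E) |B_r|,

   and this has two consequences. First, |E| is bounded below in terms of P(E)/|E| alone (a weak
   isoperimetric inequality). Second, the indicator of E is L^1-close, uniformly for bounded P(E), to its
   averages over balls of radius r; a diagonal subsequence makes the measures of E_k on countably many
   balls converge, hence makes the averages converge, hence makes the sets E_k Cauchy in measure.

   Together with lower semicontinuity of the perimeter this shows that a minimising sequence of clusters
   has a limit cluster, whose ratios lie below the limits of the ratios; lower semicontinuity and
   monotonicity of Phi conclude. The same compactness with one chamber shows that every set F inside Omega
   with finite h(F) contains a set attaining h(F). Replacing each chamber of an N-set by such a set gives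
   H <= L, and monotonicity gives L <= H, so the minimiser of H also attains L. *)
theory Submission
  imports Defs "HOL-Complex_Analysis.Great_Picard"
begin

text \<open>A minimising sequence can fail in two ways: a chamber can lose its volume in the limit,
  or oscillate without converging. A common bound M for the ratios P(E_i)/|E_i| excludes both, and
  (\<Phi>.2) supplies it from a bound on \<open>H_value\<close>. Volumes then stay above |B_r|/2
  with r = 1/(2M), the radius at which the averaged estimate loses only half of a ball, and
  perimeters stay below M |B_R|, where B_R contains \<Omega>. A diagonal argument handles only
  countably many balls, whereas averages are needed at every centre. A ball with arbitrary centre is
  therefore exhausted from inside by slightly smaller balls with centres in a dense set, which
  explains radii of the form 1/(m+1) - 1/(p+1). Translations and Tonelli are applied to bounded
  Borel sets, so chambers, which are only Lebesgue measurable and only almost contained in a ball,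
  are first replaced by Borel representatives. The infimum H must also be finite. Small disjoint
  balls form a cluster, and translation again bounds the perimeter of a ball: moving it by t changes
  it on a set of measure O(t).\<close>

section \<open>Test fields and the translation estimate\<close>

text \<open>Carrying the gradient \<open>g\<close> as an argument keeps \<open>frechet_derivative\<close> out of all later proofs.\<close>
definition C1c :: "('a::euclidean_space \<Rightarrow> real) \<Rightarrow> ('a \<Rightarrow> 'a) \<Rightarrow> bool" where
  "C1c \<psi> g \<longleftrightarrow> continuous_on UNIV g
     \<and> (\<forall>x. (\<psi> has_derivative (\<lambda>v. g x \<bullet> v)) (at x)) \<and> bounded {x. \<psi> x \<noteq> 0}"

lemma C1c_continuous: "C1c \<psi> g \<Longrightarrow> continuous_on UNIV \<psi>"
  unfolding C1c_def by (meson continuous_at_imp_continuous_on has_derivative_continuous)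

text \<open>Off the closed support, \<psi> is locally 0, so uniqueness of the derivative forces
  \<open>g\<close> to vanish there; on the closed support, which is compact, continuity bounds
  \<open>g\<close>.\<close>

lemma C1c_gradient_bounded:
  assumes "C1c \<psi> g"
  obtains B where "B > 0" "\<And>x. norm (g x) \<le> B"
proof -
  let ?K = "closure {x. \<psi> x \<noteq> 0}"
  have "compact ?K" using assms by (simp add: C1c_def)
  moreover have "continuous_on ?K g"
    using assms continuous_on_subset unfolding C1c_def by blast
  ultimately have "bounded (g ` ?K)"
    by (simp add: compact_continuous_image compact_imp_bounded)
  then obtain B where B: "B > 0" "\<And>x. x \<in> ?K \<Longrightarrow> norm (g x) \<le> B"
    unfolding bounded_pos by blast
  have "g x = 0" if "x \<notin> ?K" for x
  proof -
    have "((\<lambda>_. 0) has_derivative (\<lambda>v. g x \<bullet> v)) (at x)"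
    proof (rule has_derivative_transform_within_open[of \<psi> _ _ _ "- ?K"])
      show "(\<psi> has_derivative (\<bullet>) (g x)) (at x)" using assms by (simp add: C1c_def)
      show "\<And>y. y \<in> - ?K \<Longrightarrow> \<psi> y = 0" using closure_subset[of "{x. \<psi> x \<noteq> 0}"] by auto
    qed (use that in auto)
    then have "(\<lambda>v. g x \<bullet> v) = (\<lambda>v. 0)"
      by (rule has_derivative_unique) (rule has_derivative_const)
    then have "g x \<bullet> g x = 0" by (rule fun_cong)
    then show ?thesis by simp
  qed
  then have "norm (g x) \<le> B" for x using B by (cases "x \<in> ?K") auto
  with B(1) show ?thesis using that by blast
qed

lemma C1c_shift:
  assumes "C1c \<psi> g"
  shows "C1c (\<lambda>x. \<psi> (x + a)) (\<lambda>x. g (x + a))"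
  unfolding C1c_def
proof (intro conjI allI)
  show "continuous_on UNIV (\<lambda>x. g (x + a))"
    using assms unfolding C1c_def
    by (auto intro!: continuous_on_compose2[of UNIV g] continuous_intros)
  fix x
  have "((\<lambda>x. x + a) has_derivative (\<lambda>v. v)) (at x)"
    by (auto intro!: derivative_eq_intros)
  moreover have "(\<psi> has_derivative (\<bullet>) (g (x + a))) (at (x + a))"
    using assms by (simp add: C1c_def)
  ultimately show "((\<lambda>x. \<psi> (x + a)) has_derivative (\<bullet>) (g (x + a))) (at x)"
    using has_derivative_compose by blast
next
  have "{x. \<psi> (x + a) \<noteq> 0} \<subseteq> (\<lambda>x. x - a) ` {x. \<psi> x \<noteq> 0}"
    by (force simp: image_iff)
  moreover have "bounded ((\<lambda>x. x - a) ` {x. \<psi> x \<noteq> 0})"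
    using assms bounded_translation_minus unfolding C1c_def by blast
  ultimately show "bounded {x. \<psi> (x + a) \<noteq> 0}" using bounded_subset by blast
qed

text \<open>The translation estimate needs only fields of constant direction \<open>w\<close>: their
  divergence is a directional derivative, which is what differentiating along a translation
  produces.\<close>

lemma test_field_scaleR:
  assumes \<psi>: "C1c \<psi> g" and le: "\<And>x. \<bar>\<psi> x\<bar> \<le> 1" and w: "norm w \<le> 1"
  shows "(\<lambda>x. \<psi> x *\<^sub>R w) \<in> test_fields" "divergence (\<lambda>x. \<psi> x *\<^sub>R w) x = g x \<bullet> w"
proof -
  have D: "((\<lambda>x. \<psi> x *\<^sub>R w) has_derivative (\<lambda>v. (g x \<bullet> v) *\<^sub>R w)) (at x)" for x
    using \<psi> unfolding C1c_def by (auto intro!: derivative_eq_intros)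
  have F: "frechet_derivative (\<lambda>x. \<psi> x *\<^sub>R w) (at x) = (\<lambda>v. (g x \<bullet> v) *\<^sub>R w)" for x
    using frechet_derivative_at[OF D] by simp
  show "divergence (\<lambda>x. \<psi> x *\<^sub>R w) x = g x \<bullet> w"
    by (simp add: divergence_def F euclidean_inner[of "g x" w] inner_commute[of w])
  have "bounded {x. \<psi> x *\<^sub>R w \<noteq> 0}"
    using \<psi> unfolding C1c_def by (auto intro: bounded_subset)
  moreover have "norm (\<psi> x *\<^sub>R w) \<le> 1" for x
    using mult_mono[OF le w] by simp
  moreover have "continuous_on UNIV (\<lambda>x. (g x \<bullet> b) *\<^sub>R w)" for b
    using \<psi> unfolding C1c_def by (auto intro!: continuous_intros)
  ultimately show "(\<lambda>x. \<psi> x *\<^sub>R w) \<in> test_fields"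
    using D by (auto simp: test_fields_def F differentiable_def)
qed

text \<open>The converse passage, from a field to scalar functions, lets bounds on
  \<open>C1c\<close> functions be applied to an arbitrary divergence one coordinate at a
  time.\<close>

lemma test_field_components:
  assumes "\<phi> \<in> test_fields"
  obtains G where "\<And>b. b \<in> Basis \<Longrightarrow> C1c (\<lambda>x. \<phi> x \<bullet> b) (G b)"
    "\<And>x. divergence \<phi> x = (\<Sum>b\<in>Basis. G b x \<bullet> b)"
proof -
  \<comment> \<open>The gradient of the component along \<open>b\<close>, assembled from partial
    derivatives because \<open>test_fields\<close> asks for continuity of the derivative in basis
    directions only.\<close>
  define G where "G b x = (\<Sum>c\<in>Basis. (frechet_derivative \<phi> (at x) c \<bullet> b) *\<^sub>R c)" for b x
  have df: "(\<phi> has_derivative frechet_derivative \<phi> (at x)) (at x)" for x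
    using assms frechet_derivative_works unfolding test_fields_def by blast
  have G: "G b x \<bullet> v = frechet_derivative \<phi> (at x) v \<bullet> b" for b x v
  proof -
    interpret linear "frechet_derivative \<phi> (at x)"
      using df has_derivative_linear by blast
    have "frechet_derivative \<phi> (at x) v = frechet_derivative \<phi> (at x) (\<Sum>c\<in>Basis. (v \<bullet> c) *\<^sub>R c)"
      by (simp add: euclidean_representation)
    also have "\<dots> = (\<Sum>c\<in>Basis. (v \<bullet> c) *\<^sub>R frechet_derivative \<phi> (at x) c)"
      by (simp add: sum scale)
    finally show ?thesis
      by (simp add: G_def inner_sum_left inner_commute[of _ v] inner_sum_right mult.commute)
  qed
  have "C1c (\<lambda>x. \<phi> x \<bullet> b) (G b)" for b
    unfolding C1c_def
  proof (intro conjI allI)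
    show "continuous_on UNIV (G b)"
      using assms unfolding G_def test_fields_def by (auto intro!: continuous_intros)
    show "((\<lambda>x. \<phi> x \<bullet> b) has_derivative (\<bullet>) (G b x)) (at x)" for x
      using df[of x] by (auto intro!: derivative_eq_intros simp: G)
    have "bounded {x. \<phi> x \<noteq> 0}"
      using assms compact_imp_bounded bounded_subset closure_subset
      unfolding test_fields_def by blast
    then show "bounded {x. \<phi> x \<bullet> b \<noteq> 0}"
      by (rule bounded_subset) auto
  qed
  moreover have "divergence \<phi> x = (\<Sum>b\<in>Basis. G b x \<bullet> b)" for x
    by (simp add: divergence_def G)
  ultimately show ?thesis using that by blast
qed

lemma divergence_continuous_bounded:
  assumes "\<phi> \<in> test_fields"
  obtains B where "B > 0" "\<And>x. \<bar>divergence \<phi> x\<bar> \<le> B" "continuous_on UNIV (divergence \<phi>)"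
proof -
  obtain G where G: "\<And>b. b \<in> Basis \<Longrightarrow> C1c (\<lambda>x. \<phi> x \<bullet> b) (G b)"
    "\<And>x. divergence \<phi> x = (\<Sum>b\<in>Basis. G b x \<bullet> b)"
    using test_field_components[OF assms] by blast
  have "\<exists>B. \<forall>x. norm (G b x) \<le> B" if "b \<in> Basis" for b
    using C1c_gradient_bounded[OF G(1)[OF that]] by metis
  then obtain B where B: "\<And>b x. b \<in> Basis \<Longrightarrow> norm (G b x) \<le> B b" by metis
  have "\<bar>divergence \<phi> x\<bar> \<le> (\<Sum>b\<in>Basis. B b)" for x
    unfolding G(2)
  proof (rule order_trans[OF sum_abs], rule sum_mono)
    fix b :: 'a assume b: "b \<in> Basis"
    show "\<bar>G b x \<bullet> b\<bar> \<le> B b"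
      using Cauchy_Schwarz_ineq2[of "G b x" b] B[OF b, of x] b by simp
  qed
  then have "\<bar>divergence \<phi> x\<bar> \<le> \<bar>\<Sum>b\<in>Basis. B b\<bar> + 1" for x
    by (meson abs_ge_self add_increasing2 order_trans zero_le_one)
  moreover have "continuous_on UNIV (divergence \<phi>)"
    using G(1) unfolding G(2)[abs_def] C1c_def by (auto intro!: continuous_intros)
  ultimately show ?thesis by (intro that[of "\<bar>\<Sum>b\<in>Basis. B b\<bar> + 1"]) auto
qed

text \<open>\<open>perimeter\<close> integrates against the completed measure, while translation
  invariance and Tonelli are used for \<open>lborel\<close>; on Borel sets the two integrals of a
  continuous divergence agree.\<close>

lemma perimeter_borel:
  assumes "E \<in> sets borel"
  shows "perimeter E = (SUP \<phi>\<in>test_fields. ereal (LINT x:E|lborel. divergence \<phi> x))"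
proof -
  have "(LINT x:E|lebesgue. divergence \<phi> x) = (LINT x:E|lborel. divergence \<phi> x)"
    if "\<phi> \<in> test_fields" for \<phi> :: "'a \<Rightarrow> 'a"
  proof -
    have "continuous_on UNIV (divergence \<phi>)" using divergence_continuous_bounded[OF that] .
    then have [measurable]: "divergence \<phi> \<in> borel_measurable borel"
      by (rule borel_measurable_continuous_onI)
    have [measurable]: "E \<in> sets borel" by fact
    show ?thesis
      unfolding set_lebesgue_integral_def
      by (intro integral_completion) simp
  qed
  then show ?thesis unfolding perimeter_def by simp
qed

lemma perimeter_nonneg: "0 \<le> perimeter E"
proof -
  have "C1c (\<lambda>_::'a. 0) (\<lambda>_. 0)" by (simp add: C1c_def)
  note t = test_field_scaleR[OF this, of 0]
  then have "(\<lambda>x::'a. 0) \<in> test_fields" by simp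
  moreover have "divergence (\<lambda>x::'a. 0) x = 0" for x using t(2) by simp
  ultimately show ?thesis
    unfolding perimeter_def
    by (intro SUP_upper2[of "\<lambda>x::'a. 0"]) (simp_all add: set_lebesgue_integral_def)
qed

lemma set_integrable_bounded_continuous:
  fixes f :: "'a::euclidean_space \<Rightarrow> real"
  assumes E: "E \<in> sets borel" "emeasure lborel E < \<infinity>"
    and "continuous_on UNIV f" "\<And>x. \<bar>f x\<bar> \<le> B"
  shows "set_integrable lborel E f"
proof -
  have [measurable]: "f \<in> borel_measurable borel"
    using assms(3) by (rule borel_measurable_continuous_onI)
  show ?thesis unfolding set_integrable_def
  proof (rule Bochner_Integration.integrable_bound)
    show "integrable lborel (\<lambda>x. indicator E x * B)"
      using E by (simp add: integrable_real_indicator)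
    show "AE x in lborel. norm (indicat_real E x *\<^sub>R f x) \<le> norm (indicat_real E x * B)"
      using assms(4) by (auto split: split_indicator intro: order_trans[OF _ abs_ge_self])
  qed (use E in measurable)
qed

text \<open>Differentiation under the integral sign. The gradient bound makes \<psi> Lipschitz, so
  the difference quotients are dominated by a constant multiple of the indicator of
  \<open>E\<close>, which has finite measure.\<close>

lemma derivative_translated_integral:
  assumes \<psi>: "C1c \<psi> g" and le: "\<And>x. \<bar>\<psi> x\<bar> \<le> 1"
    and E: "E \<in> sets borel" "emeasure lborel E < \<infinity>"
  shows "((\<lambda>t. LINT x:E|lborel. \<psi> (x + t *\<^sub>R h))
           has_real_derivative (LINT x:E|lborel. g x \<bullet> h)) (at 0)"
proof -
  obtain B where B: "B > 0" "\<And>x. norm (g x) \<le> B" using C1c_gradient_bounded[OF \<psi>] by metis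
  have cont: "continuous_on UNIV \<psi>" "continuous_on UNIV g"
    using \<psi> C1c_continuous unfolding C1c_def by auto
  then have [measurable]: "\<psi> \<in> borel_measurable borel" "g \<in> borel_measurable borel"
    by (auto intro: borel_measurable_continuous_onI)
  have [measurable]: "E \<in> sets borel" by fact
  have der: "(\<psi> has_derivative (\<bullet>) (g x)) (at x)" for x using \<psi> by (simp add: C1c_def)
  have lip: "\<bar>\<psi> y - \<psi> x\<bar> \<le> B * norm (y - x)" for x y
  proof -
    have "norm (\<psi> y - \<psi> x) \<le> B * norm (y - x)"
    proof (rule differentiable_bound[of UNIV \<psi> "\<lambda>x v. g x \<bullet> v"])
      show "onorm ((\<bullet>) (g z)) \<le> B" for z
        proof (rule onorm_le)
        fix v
        have "\<bar>g z \<bullet> v\<bar> \<le> norm (g z) * norm v" by (rule Cauchy_Schwarz_ineq2)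
        also have "\<dots> \<le> B * norm v" using B(2) by (intro mult_right_mono) auto
        finally show "norm (g z \<bullet> v) \<le> B * norm v" by simp
      qed
    qed (use der in \<open>auto simp: has_derivative_at_withinI\<close>)
    then show ?thesis by simp
  qed
  have int: "set_integrable lborel E (\<lambda>x. \<psi> (x + a))" for a
    using set_integrable_bounded_continuous[OF E C1c_continuous[OF C1c_shift[OF \<psi>]] le] .
  have quot: "((\<lambda>t. (\<psi> (x + t *\<^sub>R h) - \<psi> x) / t) \<longlongrightarrow> g x \<bullet> h) (at 0)" for x
  proof -
    have "((\<lambda>t. \<psi> (x + t *\<^sub>R h)) has_derivative (\<lambda>t. g x \<bullet> (t *\<^sub>R h))) (at 0)"
      by (rule has_derivative_compose[of "\<lambda>t. x + t *\<^sub>R h" "\<lambda>t. t *\<^sub>R h" 0 UNIV \<psi>])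
        (use der[of x] in \<open>auto intro!: derivative_eq_intros\<close>)
    then have "((\<lambda>t. \<psi> (x + t *\<^sub>R h)) has_real_derivative g x \<bullet> h) (at 0)"
      unfolding has_field_derivative_def by (simp add: mult.commute[of _ "g x \<bullet> h"])
    then show ?thesis by (simp add: has_field_derivative_iff)
  qed
  have "((\<lambda>t. ((LINT x:E|lborel. \<psi> (x + t *\<^sub>R h)) - (LINT x:E|lborel. \<psi> x)) / t)
          \<longlongrightarrow> (LINT x:E|lborel. g x \<bullet> h)) (at 0)"
    unfolding tendsto_at_iff_sequentially comp_def
  proof (intro allI impI)
    fix X :: "nat \<Rightarrow> real"
    assume X0: "\<forall>i. X i \<in> UNIV - {0}" and X: "X \<longlonglongrightarrow> 0"
    have eq: "((LINT x:E|lborel. \<psi> (x + X i *\<^sub>R h)) - (LINT x:E|lborel. \<psi> x)) / X i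
        = (LINT x|lborel. indicator E x *\<^sub>R ((\<psi> (x + X i *\<^sub>R h) - \<psi> x) / X i))" for i
      unfolding scaleR_conv_of_real times_divide_eq_right
      using set_integral_diff(2)[OF int[of "X i *\<^sub>R h"] int[of 0]]
      by (simp add: set_lebesgue_integral_def)
    have "(\<lambda>i. LINT x|lborel. indicat_real E x *\<^sub>R ((\<psi> (x + X i *\<^sub>R h) - \<psi> x) / X i))
        \<longlonglongrightarrow> (LINT x|lborel. indicat_real E x *\<^sub>R (g x \<bullet> h))"
    proof (rule integral_dominated_convergence)
      show "integrable lborel (\<lambda>x. indicator E x * (B * norm h))"
        using E by (simp add: integrable_real_indicator)
      show "AE x in lborel. (\<lambda>i. indicat_real E x *\<^sub>R ((\<psi> (x + X i *\<^sub>R h) - \<psi> x) / X i))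
          \<longlonglongrightarrow> indicat_real E x *\<^sub>R (g x \<bullet> h)"
      proof (intro AE_I2 tendsto_scaleR tendsto_const)
        fix x
        show "(\<lambda>i. (\<psi> (x + X i *\<^sub>R h) - \<psi> x) / X i) \<longlonglongrightarrow> g x \<bullet> h"
          using quot[of x] X0 X unfolding tendsto_at_iff_sequentially comp_def by metis
      qed
      show "AE x in lborel. norm (indicat_real E x *\<^sub>R ((\<psi> (x + X i *\<^sub>R h) - \<psi> x) / X i))
          \<le> indicat_real E x * (B * norm h)" for i
      proof (intro AE_I2)
        fix x
        have "\<bar>\<psi> (x + X i *\<^sub>R h) - \<psi> x\<bar> / \<bar>X i\<bar> \<le> B * norm h"
          using lip[of "x + X i *\<^sub>R h" x] X0 by (simp add: divide_le_eq mult_ac)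
        then show "norm (indicat_real E x *\<^sub>R ((\<psi> (x + X i *\<^sub>R h) - \<psi> x) / X i))
          \<le> indicat_real E x * (B * norm h)"
          by (auto split: split_indicator)
      qed
    qed measurable
    then show "(\<lambda>i. ((LINT x:E|lborel. \<psi> (x + X i *\<^sub>R h)) - (LINT x:E|lborel. \<psi> x)) / X i)
        \<longlonglongrightarrow> (LINT x:E|lborel. g x \<bullet> h)"
      unfolding eq by (simp add: set_lebesgue_integral_def)
  qed
  then show ?thesis by (simp add: has_field_derivative_iff)
qed

text \<open>Applying the derivative at 0 to the shifted functions gives the derivative at every t.
  Each is the integral of a divergence up to the factor \<open>norm h\<close>, so it is at most
  \<open>norm h * P\<close>, and the mean value theorem on [0, 1] integrates this bound.\<close>

lemma integral_translation_le_perimeter: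
  assumes \<psi>: "C1c \<psi> g" and le: "\<And>x. \<bar>\<psi> x\<bar> \<le> 1"
    and E: "E \<in> sets borel" "emeasure lborel E < \<infinity>"
    and P: "perimeter E \<le> ereal P"
  shows "(LINT x:E|lborel. \<psi> (x + h)) - (LINT x:E|lborel. \<psi> x) \<le> norm h * P"
proof (cases "h = 0")
  case False
  define F where "F t = (LINT x:E|lborel. \<psi> (x + t *\<^sub>R h))" for t :: real
  have der: "(F has_real_derivative (LINT x:E|lborel. g (x + t *\<^sub>R h) \<bullet> h)) (at t)" for t
  proof -
    have "((\<lambda>s. LINT x:E|lborel. \<psi> ((x + s *\<^sub>R h) + t *\<^sub>R h))
        has_real_derivative (LINT x:E|lborel. g (x + t *\<^sub>R h) \<bullet> h)) (at 0)"
      using derivative_translated_integral[OF C1c_shift[OF \<psi>] le E] .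
    then have "((\<lambda>s. F (s + t)) has_real_derivative (LINT x:E|lborel. g (x + t *\<^sub>R h) \<bullet> h)) (at 0)"
      by (simp add: F_def algebra_simps)
    then show ?thesis using DERIV_shift[of F _ 0 t] by simp
  qed
  have bound: "(LINT x:E|lborel. g (x + t *\<^sub>R h) \<bullet> h) \<le> norm h * P" for t
  proof -
    \<comment> \<open>The supremum defining \<open>perimeter\<close> admits only fields of norm at
      most 1, hence the normalised direction; the factor \<open>norm h\<close> is restored
      below.\<close>
    define w where "w = h /\<^sub>R norm h"
    have w: "norm w \<le> 1" using False by (simp add: w_def)
    note tf = test_field_scaleR[OF C1c_shift[OF \<psi>, of "t *\<^sub>R h"] le w]
    have "ereal (LINT x:E|lborel. g (x + t *\<^sub>R h) \<bullet> w) \<le> perimeter E"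
      unfolding perimeter_borel[OF E(1)]
      by (rule SUP_upper2[OF tf(1)]) (simp add: tf(2)[abs_def])
    then have "(LINT x:E|lborel. g (x + t *\<^sub>R h) \<bullet> w) \<le> P" using P
      by (metis ereal_less_eq(3) order_trans)
    moreover have "g (x + t *\<^sub>R h) \<bullet> h = norm h * (g (x + t *\<^sub>R h) \<bullet> w)" for x
      using False by (simp add: w_def)
    ultimately show ?thesis by (simp add: mult_left_mono)
  qed
  obtain z where "F 1 - F 0 = (1 - 0) * (LINT x:E|lborel. g (x + z *\<^sub>R h) \<bullet> h)"
    using MVT2[of 0 1 F "\<lambda>t. (LINT x:E|lborel. g (x + t *\<^sub>R h) \<bullet> h)"] der by auto
  then show ?thesis using bound[of z] by (simp add: F_def)
qed simp

section \<open>Cutoff functions of class C^1\<close>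

text \<open>Squaring removes the kink of the positive part at 0. One continuous derivative is all
  that test fields require, so this serves as the building block of the cutoff below.\<close>

lemma DERIV_pos_part_square: "((\<lambda>t::real. (max 0 t)\<^sup>2) has_real_derivative 2 * max 0 t) (at t)"
proof -
  consider "t > 0" | "t < 0" | "t = 0" by linarith
  then show ?thesis
  proof cases
    case 1
    have "((\<lambda>t::real. t\<^sup>2) has_real_derivative 2 * max 0 t) (at t)"
      using 1 by (auto intro!: derivative_eq_intros)
    then show ?thesis
      by (rule has_field_derivative_transform_within_open[of _ _ _ "{0<..}"]) (use 1 in auto)
  next
    case 2
    have "((\<lambda>t::real. 0) has_real_derivative 2 * max 0 t) (at t)"
      using 2 by (auto intro!: derivative_eq_intros)
    then show ?thesis
      by (rule has_field_derivative_transform_within_open[of _ _ _ "{..<0}"]) (use 2 in auto)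
  next
    case 3
    have "((\<lambda>h::real. (max 0 h)\<^sup>2 / h) \<longlongrightarrow> 0) (at 0)"
    proof (rule Lim_null_comparison)
      have "norm ((max 0 h)\<^sup>2 / h) \<le> \<bar>h\<bar>" for h :: real
        by (cases "h > 0") (auto simp: power2_eq_square)
      then show "\<forall>\<^sub>F h in at 0. norm ((max 0 h)\<^sup>2 / h) \<le> \<bar>h\<bar>" by simp
      show "((\<lambda>h::real. \<bar>h\<bar>) \<longlongrightarrow> 0) (at 0)" by (rule tendsto_rabs_zero) (rule tendsto_ident_at)
    qed
    then show ?thesis using 3 by (simp add: has_field_derivative_iff)
  qed
qed

lemma C1_bump:
  fixes K1 K2 :: "'a::euclidean_space set"
  assumes K1: "compact K1" and K2: "closed K2" and "K1 \<inter> K2 = {}"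
  obtains \<psi> g where "C1c \<psi> g" "\<And>x. 0 \<le> \<psi> x" "\<And>x. \<psi> x \<le> 1"
    "\<And>x. x \<in> K1 \<Longrightarrow> \<psi> x = 1" "\<And>x. x \<in> K2 \<Longrightarrow> \<psi> x = 0"
proof -
  have "\<exists>r>0. ball c r \<inter> K2 = {}" if "c \<in> K1" for c
    using open_contains_ball[of "- K2"] K2 that assms(3) by (metis ComplI closed_def disjoint_eq_subset_Compl disjoint_iff)
  then obtain r where r: "\<And>c. c \<in> K1 \<Longrightarrow> r c > 0" "\<And>c. c \<in> K1 \<Longrightarrow> ball c (r c) \<inter> K2 = {}"
    by metis
  have "K1 \<subseteq> (\<Union>c\<in>K1. ball c (r c))" using r(1) by auto
  then obtain T where T: "T \<subseteq> K1" "finite T" "K1 \<subseteq> (\<Union>c\<in>T. ball c (r c))"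
    by (meson K1 compactE_image open_ball)
  \<comment> \<open>A sum of squared positive parts of paraboloids is \<open>C\<^sup>1\<close>, at least \<open>m > 0\<close> on \<open>K1\<close> and \<open>0\<close> on \<open>K2\<close>;
    clamping its values to \<open>[0, m]\<close> by another squared positive part gives the bump.\<close>
  define k where "k c = 1 / (r c)\<^sup>2" for c
  define p where "p c x = 1 - k c * ((x - c) \<bullet> (x - c))" for c x
  define U where "U x = (\<Sum>c\<in>T. (max 0 (p c x))\<^sup>2)" for x
  define V where "V x = (\<Sum>c\<in>T. (2 * max 0 (p c x)) *\<^sub>R (- 2 * k c) *\<^sub>R (x - c))" for x
  have p_pos: "p c x > 0 \<longleftrightarrow> x \<in> ball c (r c)" if "c \<in> T" for c x
  proof -
    have "r c > 0" using that T r by auto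
    moreover have "(norm (x - c))\<^sup>2 < (r c)\<^sup>2 \<longleftrightarrow> norm (x - c) < r c"
      using \<open>r c > 0\<close> by (auto intro: power2_less_imp_less power_strict_mono)
    ultimately show ?thesis
      by (simp add: p_def k_def dist_norm norm_minus_commute flip: power2_norm_eq_inner)
  qed
  have contp: "continuous_on UNIV (p c)" for c
    unfolding p_def by (intro continuous_intros)
  have contU: "continuous_on UNIV U" and contV: "continuous_on UNIV V"
    unfolding U_def[abs_def] V_def[abs_def] by (intro continuous_intros contp)+
  have derU: "(U has_derivative (\<lambda>v. V x \<bullet> v)) (at x)" for x
  proof -
    have dp: "(p c has_derivative (\<lambda>v. (- 2 * k c) *\<^sub>R (x - c) \<bullet> v)) (at x)" for c
      unfolding p_def[abs_def]
      by (auto intro!: derivative_eq_intros simp: inner_commute algebra_simps)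
    have "((\<lambda>x. (max 0 (p c x))\<^sup>2) has_derivative
        (\<lambda>v. (2 * max 0 (p c x)) * ((- 2 * k c) *\<^sub>R (x - c) \<bullet> v))) (at x)" for c
      by (rule has_derivative_compose[OF dp
          DERIV_pos_part_square[unfolded has_field_derivative_def]])
    then show ?thesis
      unfolding U_def[abs_def] V_def inner_sum_left
      by (intro has_derivative_sum) (simp add: mult.assoc)
  qed
  have U0: "U x \<ge> 0" for x unfolding U_def by (simp add: sum_nonneg)
  have Upos: "U x > 0" if x: "x \<in> K1" for x
  proof -
    obtain c where c: "c \<in> T" "x \<in> ball c (r c)" using T(3) x by blast
    then have "0 < (max 0 (p c x))\<^sup>2" using p_pos[OF c(1), of x] by (metis max.absorb2 less_imp_le zero_less_power)
    also have "\<dots> \<le> U x" unfolding U_def using c T by (intro member_le_sum) auto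
    finally show ?thesis .
  qed
  have Uz: "U x = 0" if "\<And>c. c \<in> T \<Longrightarrow> x \<notin> ball c (r c)" for x
    unfolding U_def
  proof (rule sum.neutral, rule ballI)
    fix c assume "c \<in> T"
    then have "\<not> p c x > 0" using that p_pos by blast
    then show "(max 0 (p c x))\<^sup>2 = 0" by simp
  qed
  obtain m where m: "m > 0" "\<And>x. x \<in> K1 \<Longrightarrow> m \<le> U x"
  proof (cases "K1 = {}")
    case False
    obtain x where "x \<in> K1" "\<And>y. y \<in> K1 \<Longrightarrow> U x \<le> U y"
      using continuous_attains_inf[OF K1 False] contU continuous_on_subset by blast
    then show ?thesis using that[of "U x"] Upos by blast
  qed (use that[of 1] in auto)
  define \<psi> where "\<psi> x = 1 - (max 0 (1 - U x / m))\<^sup>2" for x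
  define g where "g x = (2 * max 0 (1 - U x / m) / m) *\<^sub>R V x" for x
  have b: "0 \<le> max 0 (1 - U x / m)" "max 0 (1 - U x / m) \<le> 1" for x using U0[of x] m by auto
  show ?thesis
  proof (rule that[of \<psi> g])
    show "C1c \<psi> g"
      unfolding C1c_def
    proof (intro conjI allI)
      show "continuous_on UNIV g"
        unfolding g_def using m by (intro continuous_intros contU contV) auto
      fix x
      have "((\<lambda>x. 1 - U x / m) has_derivative (\<lambda>v. - (V x \<bullet> v) / m)) (at x)"
        using derU[of x] m by (auto intro!: derivative_eq_intros)
      from has_derivative_compose[OF this DERIV_pos_part_square[unfolded has_field_derivative_def]]
      have "((\<lambda>x. (max 0 (1 - U x / m))\<^sup>2) has_derivative
          (\<lambda>v. 2 * max 0 (1 - U x / m) * (- (V x \<bullet> v) / m))) (at x)" .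
      from has_derivative_diff[OF has_derivative_const this]
      show "(\<psi> has_derivative (\<bullet>) (g x)) (at x)"
        unfolding \<psi>_def[abs_def] g_def by (rule has_derivative_eq_rhs) (simp add: fun_eq_iff)
    next
      have "\<psi> x = 0" if "x \<notin> (\<Union>c\<in>T. ball c (r c))" for x
        using Uz[of x] that by (auto simp: \<psi>_def)
      then have "{x. \<psi> x \<noteq> 0} \<subseteq> (\<Union>c\<in>T. ball c (r c))" by blast
      moreover have "bounded (\<Union>c\<in>T. ball c (r c))" using T by auto
      ultimately show "bounded {x. \<psi> x \<noteq> 0}" by (rule bounded_subset[rotated])
    qed
    show "0 \<le> \<psi> x" for x using power_mono[OF b(2,1), of x 2] by (simp add: \<psi>_def)
    show "\<psi> x \<le> 1" for x by (simp add: \<psi>_def)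
    show "\<psi> x = 1" if "x \<in> K1" for x using m(2)[OF that] m(1) by (simp add: \<psi>_def)
    show "\<psi> x = 0" if x: "x \<in> K2" for x
    proof -
      have "x \<notin> ball c (r c)" if "c \<in> T" for c using r(2)[of c] T(1) that x by blast
      then show ?thesis using Uz[of x] by (simp add: \<psi>_def)
    qed
  qed
qed

lemma inner_compact:
  fixes S :: "'a::euclidean_space set"
  assumes "S \<in> sets borel" "bounded S" "e > 0"
  obtains K where "compact K" "K \<subseteq> S" "measure lborel (S - K) < e"
proof -
  have "S \<in> sets lebesgue" using assms(1) by (simp add: sets_completionI_sets)
  from sets_lebesgue_inner_closed[OF this assms(3)]
  obtain K where K: "closed K" "K \<subseteq> S" "S - K \<in> lmeasurable" "emeasure lebesgue (S - K) < ennreal e"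
    by blast
  have "compact K" using K(1,2) assms(2) bounded_subset compact_eq_bounded_closed by blast
  moreover have "S - K \<in> sets borel" using assms K by auto
  then have "measure lborel (S - K) = measure lebesgue (S - K)" by simp
  then have "measure lborel (S - K) < e"
    using K(3,4) assms(3) by (simp add: emeasure_eq_measure2 ennreal_less_iff fmeasurableD2)
  ultimately show ?thesis using that K by blast
qed

section \<open>From test functions to sets\<close>

lemma integral_lborel_translation:
  fixes f :: "'a::euclidean_space \<Rightarrow> real"
  assumes "f \<in> borel_measurable borel"
  shows "(LINT x|lborel. f (x + h)) = (LINT x|lborel. f x)"
proof -
  have "(LINT x|lborel. f x) = (LINT x|distr lborel borel ((+) h). f x)"
    by (simp add: lborel_distr_plus)
  also have "\<dots> = (LINT x|lborel. f (h + x))"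
    using assms by (intro integral_distr) auto
  finally show ?thesis by (simp add: add.commute)
qed

lemma nn_integral_lborel_translation:
  fixes f :: "'a::euclidean_space \<Rightarrow> ennreal"
  assumes "f \<in> borel_measurable borel"
  shows "(\<integral>\<^sup>+ x. f (x + h) \<partial>lborel) = (\<integral>\<^sup>+ x. f x \<partial>lborel)"
proof -
  have "(\<integral>\<^sup>+ x. f x \<partial>lborel) = (\<integral>\<^sup>+ x. f x \<partial>distr lborel borel ((+) h))"
    by (simp add: lborel_distr_plus)
  also have "\<dots> = (\<integral>\<^sup>+ x. f (h + x) \<partial>lborel)"
    using assms by (intro nn_integral_distr) auto
  finally show ?thesis by (simp add: add.commute)
qed

text \<open>With \<open>A\<close> the translate of \<open>E\<close> by \<open>- h\<close>, take a
  cutoff \<psi> equal to 1 on most of \<open>A - E\<close> and to 0 on most of \<open>E - A\<close>;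
  its values on \<open>A \<inter> E\<close> cancel. The integral of \<psi> over \<open>A\<close>
  minus that over \<open>E\<close> is then almost the measure of \<open>A - E\<close>. As
  \<open>A\<close> and \<open>E\<close> have equal measure, so have \<open>A - E\<close> and
  \<open>E - A\<close>, and the latter is the set in the claim.\<close>

lemma measure_diff_translation_le_perimeter:
  fixes E :: "'a::euclidean_space set"
  assumes E: "E \<in> sets borel" "bounded E" and P: "perimeter E \<le> ereal P"
  shows "measure lborel {x \<in> E. x + h \<notin> E} \<le> norm h * P"
proof -
  define A where "A = {x. x + h \<in> E}"
  have [measurable]: "E \<in> sets borel" by fact
  have A [measurable]: "A \<in> sets borel" unfolding A_def by measurable
  have AE: "A = (\<lambda>x. - h + x) ` E" unfolding A_def by (force simp: image_iff)
  have bA: "bounded A" unfolding AE using E bounded_translation by blast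
  have mA: "measure lborel A = measure lborel E"
    using measure_translation[of "- h" E] A E unfolding AE by simp
  have fin: "emeasure lborel E < \<infinity>" "emeasure lborel A < \<infinity>"
    using bA E emeasure_bounded_finite by auto
  \<comment> \<open>One \<open>e\<close> pays for the part of \<open>A - E\<close> outside
    \<open>K1\<close>, the other for the part of \<open>E - A\<close> outside
    \<open>K2\<close>.\<close>
  have "measure lborel (A - E) \<le> norm h * P + 2 * e" if "e > 0" for e
  proof -
    have "bounded (A - E)" "bounded (E - A)" using bA E bounded_diff by blast+
    then obtain K1 K2 where K1: "compact K1" "K1 \<subseteq> A - E" "measure lborel ((A - E) - K1) < e"
      and K2: "compact K2" "K2 \<subseteq> E - A" "measure lborel ((E - A) - K2) < e"
      using inner_compact[of "A - E" e] inner_compact[of "E - A" e] \<open>e > 0\<close> E A by (metis sets.Diff)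
    have [measurable]: "K1 \<in> sets borel" "K2 \<in> sets borel"
      using K1 K2 by (auto intro: borel_compact)
    have "closed K2" "K1 \<inter> K2 = {}" using K1 K2 compact_imp_closed by auto
    from C1_bump[OF K1(1) this] obtain \<psi> g where \<psi>: "C1c \<psi> g" "\<And>x. 0 \<le> \<psi> x" "\<And>x. \<psi> x \<le> 1"
      "\<And>x. x \<in> K1 \<Longrightarrow> \<psi> x = 1" "\<And>x. x \<in> K2 \<Longrightarrow> \<psi> x = 0" by blast
    have le: "\<bar>\<psi> x\<bar> \<le> 1" for x using \<psi>(2,3)[of x] by simp
    have [measurable]: "\<psi> \<in> borel_measurable borel"
      using C1c_continuous[OF \<psi>(1)] by (rule borel_measurable_continuous_onI)
    have int: "integrable lborel (\<lambda>x. indicator S x * \<psi> x)" if "S \<in> {A, E}" for S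
      using set_integrable_bounded_continuous[of S \<psi> 1] C1c_continuous[OF \<psi>(1)] le that fin A E
      unfolding set_integrable_def by auto
    have fin': "emeasure lborel S < \<infinity>" if "S \<subseteq> A \<union> E" for S
      by (rule emeasure_bounded_finite, rule bounded_subset[OF _ that]) (use bA E in auto)
    have int': "integrable lborel (\<lambda>x. indicat_real S x)" if "S \<subseteq> A \<union> E" "S \<in> sets borel" for S
      using fin'[OF that(1)] that(2) by simp
    have sub: "K1 \<subseteq> A \<union> E" "E - A - K2 \<subseteq> A \<union> E" using K1 by auto
    have "measure lborel K1 - measure lborel (E - A - K2)
        = (LINT x|lborel. indicator K1 x - indicator (E - A - K2) x)"
      by (subst Bochner_Integration.integral_diff) (use int' sub in auto)
    \<comment> \<open>Pointwise: on \<open>A - E\<close> the right side is \<psi>, which is 1 on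
      \<open>K1\<close>; on \<open>E - A\<close> it is -\<psi>, which is 0 on \<open>K2\<close> and
      at least -1 elsewhere; everywhere else both sides are 0.\<close>
    also have "\<dots> \<le> (LINT x|lborel. indicator A x * \<psi> x - indicator E x * \<psi> x)"
    proof (rule integral_mono)
      show "integrable lborel (\<lambda>x. indicat_real K1 x - indicat_real (E - A - K2) x)"
        using int' sub by (intro Bochner_Integration.integrable_diff) auto
      show "integrable lborel (\<lambda>x. indicat_real A x * \<psi> x - indicat_real E x * \<psi> x)"
        using int by (intro Bochner_Integration.integrable_diff) auto
      show "indicat_real K1 x - indicat_real (E - A - K2) x
          \<le> indicat_real A x * \<psi> x - indicat_real E x * \<psi> x" for x
        using K1(2) K2(2) \<psi>(2,3)[of x] \<psi>(4,5)[of x] by (auto simp: indicator_def)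
    qed
    also have "\<dots> = (LINT x|lborel. indicator A x * \<psi> x) - (LINT x|lborel. indicator E x * \<psi> x)"
      using int by (intro Bochner_Integration.integral_diff) auto
    also have "(LINT x|lborel. indicator A x * \<psi> x) = (LINT x|lborel. indicator E x * \<psi> (x - h))"
      using integral_lborel_translation[of "\<lambda>x. indicat_real E x * \<psi> (x - h)" h]
      by (simp add: A_def indicator_def)
    also have "\<dots> - (LINT x|lborel. indicator E x * \<psi> x) \<le> norm h * P"
      using integral_translation_le_perimeter[OF \<psi>(1) le E(1) fin(1) P, of "- h"]
      by (simp add: set_lebesgue_integral_def)
    finally have *: "measure lborel K1 - measure lborel (E - A - K2) \<le> norm h * P" .
    have "measure lborel (A - E) = measure lborel K1 + measure lborel (A - E - K1)"
    proof -
      have "A - E \<subseteq> A \<union> E" by blast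
      with fin'[OF this] have "emeasure lborel (A - E) \<noteq> \<infinity>" by simp
      from measure_Diff[OF this _ _ K1(2)] show ?thesis by simp
    qed
    then show ?thesis using * K1 K2 by simp
  qed
  note eps = this
  have "measure lborel (A - E) \<le> norm h * P"
  proof (rule field_le_epsilon)
    fix e :: real assume "e > 0"
    with eps[of "e / 2"]
    show "measure lborel (A - E) \<le> norm h * P + e" by simp
  qed
  moreover have "measure lborel (E - A) = measure lborel (A - E)"
    using measure_Diff[of lborel E "E \<inter> A"] measure_Diff[of lborel A "A \<inter> E"] fin mA
    by (simp add: Diff_Int Int_commute) 
  moreover have "{x \<in> E. x + h \<notin> E} = E - A" by (auto simp: A_def)
  ultimately show ?thesis by simp
qed

section \<open>Averages over balls\<close>

lemma borel_measurable_emeasure_Int_ball: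
  fixes E :: "'a::euclidean_space set"
  assumes [measurable]: "E \<in> sets borel"
  shows "(\<lambda>x. emeasure lborel (E \<inter> ball x r)) \<in> borel_measurable borel"
proof -
  have "{z \<in> space (lborel \<Otimes>\<^sub>M lborel). snd z \<in> E \<and> dist (fst z) (snd z) < r} \<in> sets (lborel \<Otimes>\<^sub>M lborel)"
    by measurable
  from lborel.measurable_emeasure_Pair[OF this]
  show ?thesis by (simp add: space_pair_measure vimage_def Int_def ball_def)
qed

text \<open>Both integrals are the measure of the pairs (x, y) with x in \<open>E\<close>, y outside
  \<open>E\<close> and distance below \<open>r\<close>, sliced along x or along y. The substitution
  y = x + h and Tonelli reduce this measure to the translation estimate for each h of norm below
  \<open>r\<close>.\<close>

lemma integral_ball_diff_le_perimeter:
  fixes E :: "'a::euclidean_space set"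
  assumes E: "E \<in> sets borel" "bounded E" and P: "perimeter E \<le> ereal P"
  shows "(\<integral>\<^sup>+x. indicator E x * emeasure lborel (ball x r - E) \<partial>lborel)
           \<le> ennreal (r * P) * emeasure lborel (ball (0::'a) r)"
    and "(\<integral>\<^sup>+x. indicator (- E) x * emeasure lborel (E \<inter> ball x r) \<partial>lborel)
           \<le> ennreal (r * P) * emeasure lborel (ball (0::'a) r)"
proof -
  have [measurable]: "E \<in> sets borel" by fact
  have P0: "P \<ge> 0" using perimeter_nonneg[of E] P by (metis ereal_less_eq(5) order_trans)
  define f :: "'a \<Rightarrow> 'a \<Rightarrow> ennreal"
    where "f x y = indicator {z. fst z \<in> E \<and> snd z \<notin> E \<and> dist (fst z) (snd z) < r} (x, y)" for x y
  define g :: "'a \<Rightarrow> 'a \<Rightarrow> ennreal"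
    where "g x h = indicator {z. fst z \<in> E \<and> fst z + snd z \<notin> E \<and> norm (snd z) < r} (x, h)" for x h
  have meas: "(\<lambda>(x, y). f x y) \<in> borel_measurable (lborel \<Otimes>\<^sub>M lborel)"
    "(\<lambda>(x, y). g x y) \<in> borel_measurable (lborel \<Otimes>\<^sub>M lborel)"
    unfolding f_def g_def case_prod_beta prod.collapse
    by (auto intro!: borel_measurable_indicator' simp: space_pair_measure) measurable
  have fg: "(\<integral>\<^sup>+y. f x y \<partial>lborel) = (\<integral>\<^sup>+h. g x h \<partial>lborel)" for x
  proof -
    have "(\<lambda>y. f x y) \<in> borel_measurable borel"
      using measurable_compose_Pair1[OF _ meas(1), of x] by simp
    from nn_integral_lborel_translation[OF this, of x]
    have "(\<integral>\<^sup>+y. f x y \<partial>lborel) = (\<integral>\<^sup>+h. f x (h + x) \<partial>lborel)" by simp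
    also have "\<dots> = (\<integral>\<^sup>+h. g x h \<partial>lborel)"
      by (intro nn_integral_cong) (auto simp: f_def g_def indicator_def dist_norm add.commute)
    finally show ?thesis .
  qed
  have ginner: "(\<integral>\<^sup>+x. g x h \<partial>lborel) \<le> ennreal (r * P) * indicator (ball 0 r) h" for h
  proof (cases "norm h < r")
    case True
    have "(\<integral>\<^sup>+x. g x h \<partial>lborel) = (\<integral>\<^sup>+x. indicator {x \<in> E. x + h \<notin> E} x \<partial>lborel)"
      by (intro nn_integral_cong) (auto simp: g_def indicator_def True)
    also have "\<dots> = emeasure lborel {x \<in> E. x + h \<notin> E}"
      by (intro nn_integral_indicator) measurable
    also have "\<dots> = ennreal (measure lborel {x \<in> E. x + h \<notin> E})"
      using emeasure_bounded_finite[of "{x \<in> E. x + h \<notin> E}"] bounded_subset[OF E(2)]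
      by (intro emeasure_eq_ennreal_measure) auto
    also have "\<dots> \<le> ennreal (r * P)"
    proof (rule ennreal_leI)
      have "measure lborel {x \<in> E. x + h \<notin> E} \<le> norm h * P"
        by (rule measure_diff_translation_le_perimeter[OF E P])
      also have "\<dots> \<le> r * P" using True P0 by (intro mult_right_mono) auto
      finally show "measure lborel {x \<in> E. x + h \<notin> E} \<le> r * P" .
    qed
    finally show ?thesis using True by simp
  qed (simp add: g_def)
  have "(\<integral>\<^sup>+x. (\<integral>\<^sup>+y. f x y \<partial>lborel) \<partial>lborel) = (\<integral>\<^sup>+h. (\<integral>\<^sup>+x. g x h \<partial>lborel) \<partial>lborel)"
    unfolding fg using lborel_pair.Fubini'[OF meas(2)] by simp
  also have "\<dots> \<le> (\<integral>\<^sup>+h. ennreal (r * P) * indicator (ball 0 r) h \<partial>(lborel::'a measure))"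
    by (intro nn_integral_mono ginner)
  also have "\<dots> = ennreal (r * P) * emeasure lborel (ball (0::'a) r)"
    by (simp add: nn_integral_cmult_indicator)
  finally have main: "(\<integral>\<^sup>+x. (\<integral>\<^sup>+y. f x y \<partial>lborel) \<partial>lborel) \<le> ennreal (r * P) * emeasure lborel (ball (0::'a) r)" .
  have "(\<integral>\<^sup>+y. f x y \<partial>lborel) = indicator E x * emeasure lborel (ball x r - E)" for x
  proof -
    have "(\<integral>\<^sup>+y. f x y \<partial>lborel) = (\<integral>\<^sup>+y. indicator E x * indicator (ball x r - E) y \<partial>lborel)"
      by (intro nn_integral_cong) (auto simp: f_def indicator_def)
    also have "\<dots> = indicator E x * emeasure lborel (ball x r - E)"
      by (intro nn_integral_cmult_indicator) measurable
    finally show ?thesis .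
  qed
  with main show "(\<integral>\<^sup>+x. indicator E x * emeasure lborel (ball x r - E) \<partial>lborel)
      \<le> ennreal (r * P) * emeasure lborel (ball (0::'a) r)" by simp
  have "(\<integral>\<^sup>+x. f x y \<partial>lborel) = indicator (- E) y * emeasure lborel (E \<inter> ball y r)" for y
  proof -
    have "(\<integral>\<^sup>+x. f x y \<partial>lborel) = (\<integral>\<^sup>+x. indicator (- E) y * indicator (E \<inter> ball y r) x \<partial>lborel)"
      by (intro nn_integral_cong) (auto simp: f_def indicator_def dist_commute)
    also have "\<dots> = indicator (- E) y * emeasure lborel (E \<inter> ball y r)"
      by (intro nn_integral_cmult_indicator) measurable
    finally show ?thesis .
  qed
  moreover have "(\<integral>\<^sup>+y. (\<integral>\<^sup>+x. f x y \<partial>lborel) \<partial>lborel) = (\<integral>\<^sup>+x. (\<integral>\<^sup>+y. f x y \<partial>lborel) \<partial>lborel)"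
    using lborel_pair.Fubini'[OF meas(1)] by simp
  ultimately show "(\<integral>\<^sup>+x. indicator (- E) x * emeasure lborel (E \<inter> ball x r) \<partial>lborel)
      \<le> ennreal (r * P) * emeasure lborel (ball (0::'a) r)" using main by simp
qed

lemma measure_lborel_ball_eq: "measure lborel (ball (x::'a::euclidean_space) r) = measure lborel (ball (0::'a) r)"
  using measure_translation[of x "ball 0 r"] by (simp add: image_add_ball)

lemma emeasure_lborel_bounded:
  fixes S :: "'a::euclidean_space set"
  assumes "bounded S"
  shows "emeasure lborel S = ennreal (measure lborel S)"
  using emeasure_bounded_finite[OF assms] by (intro emeasure_eq_ennreal_measure) auto

text \<open>For radius \<open>r = 1 / (2 M)\<close> the averaged translation estimate reads \<open>|E| (|B| - |E|) \<le> |E| |B| / 2\<close>.\<close>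
lemma volume_lower_bound:
  fixes E :: "'a::euclidean_space set"
  assumes E: "E \<in> sets borel" "bounded E" and M: "M > 0" and pos: "measure lborel E > 0"
    and P: "perimeter E \<le> ereal (M * measure lborel E)"
  shows "measure lborel (ball (0::'a) (1 / (2 * M))) / 2 \<le> measure lborel E"
proof (rule ccontr)
  define r where "r = 1 / (2 * M)"
  define V where "V = measure lborel (ball (0::'a) r)"
  define m where "m = measure lborel E"
  assume "\<not> measure lborel (ball (0::'a) (1 / (2 * M))) / 2 \<le> measure lborel E"
  then have lt: "m < V / 2" by (simp add: V_def r_def m_def)
  have [measurable]: "E \<in> sets borel" by fact
  have em: "emeasure lborel E = ennreal m" using emeasure_lborel_bounded[OF E(2)] by (simp add: m_def)
  have "V - m \<le> measure lborel (ball x r - E)" for x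
  proof -
    have "measure lborel (ball x r) = measure lborel (ball x r - E) + measure lborel (ball x r \<inter> E)"
      using measure_Diff[of lborel "ball x r" "ball x r \<inter> E"] emeasure_lborel_ball_finite[of x r]
      by (simp add: Diff_Int)
    moreover have "measure lborel (ball x r \<inter> E) \<le> m"
      unfolding m_def using emeasure_bounded_finite[OF E(2)] by (intro measure_mono_fmeasurable) (auto simp: fmeasurable_def)
    ultimately show ?thesis by (simp add: measure_lborel_ball_eq[of x] V_def)
  qed
  then have "indicator E x * ennreal (V - m) \<le> indicator E x * emeasure lborel (ball x r - E)" for x
    by (auto simp: emeasure_lborel_bounded bounded_diff indicator_def intro!: ennreal_leI)
  then have "(\<integral>\<^sup>+x. ennreal (V - m) * indicator E x \<partial>lborel)
      \<le> (\<integral>\<^sup>+x. indicator E x * emeasure lborel (ball x r - E) \<partial>lborel)"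
    by (intro nn_integral_mono) (simp add: mult.commute)
  also have "\<dots> \<le> ennreal (r * (M * measure lborel E)) * emeasure lborel (ball (0::'a) r)"
    by (rule integral_ball_diff_le_perimeter(1)[OF E P])
  also have "\<dots> = ennreal (m / 2 * V)"
    using M by (simp add: r_def m_def V_def emeasure_lborel_bounded flip: ennreal_mult)
  also have "(\<integral>\<^sup>+x. ennreal (V - m) * indicator E x \<partial>lborel) = ennreal ((V - m) * m)"
    using lt pos by (simp add: nn_integral_cmult_indicator em ennreal_mult m_def)
  finally have "(V - m) * m \<le> m / 2 * V"
    using pos by (simp add: ennreal_le_iff m_def V_def)
  then have "V - m \<le> V / 2" using pos by (simp add: m_def field_simps)
  with lt show False by simp
qed

text \<open>The deviation from the average is the share of the ball outside \<open>E\<close> when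
  the centre lies in \<open>E\<close>, and the share inside \<open>E\<close> otherwise. Each of the
  two preceding integrals contributes \<open>r * P\<close>, hence the factor 2.\<close>

lemma integral_ball_average_diff_le_perimeter:
  fixes E :: "'a::euclidean_space set"
  assumes E: "E \<in> sets borel" "bounded E" and P: "perimeter E \<le> ereal P" and r: "r > 0"
  shows "(\<integral>\<^sup>+x. ennreal \<bar>indicat_real E x - measure lborel (E \<inter> ball x r) / measure lborel (ball (0::'a) r)\<bar> \<partial>lborel)
           \<le> ennreal (2 * r * P)"
proof -
  define V where "V = measure lborel (ball (0::'a) r)"
  have V: "V > 0" using r by (simp add: V_def)
  have [measurable]: "E \<in> sets borel" by fact
  have P0: "P \<ge> 0" using perimeter_nonneg[of E] P by (metis ereal_less_eq(5) order_trans)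
  let ?f = "\<lambda>x. indicator E x * emeasure lborel (ball x r - E)"
  let ?g = "\<lambda>x. indicator (- E) x * emeasure lborel (E \<inter> ball x r)"
  have split: "measure lborel (ball x r - E) = V - measure lborel (E \<inter> ball x r)" for x
    using measure_Diff[of lborel "ball x r" "E \<inter> ball x r"] emeasure_lborel_ball_finite[of x r]
    by (simp add: Diff_Int measure_lborel_ball_eq[of x] V_def)
  \<comment> \<open>Written as a difference, the measure of \<open>ball x r - E\<close> inherits its
    measurability in x from that of \<open>E \<inter> ball x r\<close>.\<close>
  have emsplit: "emeasure lborel (ball x r - E) = ennreal V - emeasure lborel (E \<inter> ball x r)" for x
    by (simp add: emeasure_lborel_bounded bounded_diff bounded_Int split ennreal_minus)
  note borel_measurable_emeasure_Int_ball[OF E(1), measurable]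
  have [measurable]: "?f \<in> borel_measurable lborel" "?g \<in> borel_measurable lborel"
    unfolding emsplit by measurable
  have "ennreal \<bar>indicat_real E x - measure lborel (E \<inter> ball x r) / V\<bar> = (?f x + ?g x) * ennreal (1 / V)" for x
  proof (cases "x \<in> E")
    case True
    have "1 - measure lborel (E \<inter> ball x r) / V = measure lborel (ball x r - E) * (1 / V)"
      using V by (simp add: split field_simps)
    then show ?thesis
      using True V by (simp add: emeasure_lborel_bounded bounded_diff flip: ennreal_mult)
  next
    case False
    then show ?thesis
      using V by (simp add: emeasure_lborel_bounded bounded_Int flip: ennreal_mult)
  qed
  then have "(\<integral>\<^sup>+x. ennreal \<bar>indicat_real E x - measure lborel (E \<inter> ball x r) / V\<bar> \<partial>lborel)
      = (\<integral>\<^sup>+x. (?f x + ?g x) * ennreal (1 / V) \<partial>lborel)" by simp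
  also have "\<dots> = (\<integral>\<^sup>+x. ?f x + ?g x \<partial>lborel) * ennreal (1 / V)"
    by (rule nn_integral_multc) measurable
  also have "(\<integral>\<^sup>+x. ?f x + ?g x \<partial>lborel) = (\<integral>\<^sup>+x. ?f x \<partial>lborel) + (\<integral>\<^sup>+x. ?g x \<partial>lborel)"
    by (rule nn_integral_add) measurable
  also have "\<dots> * ennreal (1 / V)
      \<le> (ennreal (r * P) * ennreal V + ennreal (r * P) * ennreal V) * ennreal (1 / V)"
    using integral_ball_diff_le_perimeter[OF E P, of r]
    by (intro mult_right_mono add_mono) (auto simp: emeasure_lborel_bounded V_def)
  also have "\<dots> = ennreal (2 * r * P)"
    using V P0 r by (simp flip: ennreal_mult ennreal_plus)
  finally show ?thesis by (simp add: V_def)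
qed

section \<open>Compactness\<close>

lemma fmeasurable_bounded_borel:
  fixes S :: "'a::euclidean_space set"
  assumes "S \<in> sets borel" "bounded S"
  shows "S \<in> fmeasurable lborel"
  using assms emeasure_bounded_finite by (auto simp: fmeasurable_def)

text \<open>If q is within 1/(p+1) of x, then the ball around q with radius reduced by 1/(p+1) lies
  in \<open>ball x r\<close>, and only the difference of the two volumes is lost. That loss is the
  same for every set \<open>E k\<close> and tends to 0, so a three-epsilon argument applies.\<close>

lemma Cauchy_measure_Int_ball:
  fixes E :: "nat \<Rightarrow> 'a::euclidean_space set"
  assumes E: "\<And>k. E k \<in> sets borel" and r: "r > 0"
    and D: "closure D = UNIV"
    and conv: "\<And>q p. q \<in> D \<Longrightarrow> convergent (\<lambda>k. measure lborel (E k \<inter> ball q (r - 1 / real (Suc p))))"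
  shows "convergent (\<lambda>k. measure lborel (E k \<inter> ball x r))"
  unfolding Cauchy_convergent_iff[symmetric]
proof (rule metric_CauchyI)
  fix e :: real assume e: "e > 0"
  let ?c = "unit_ball_vol (real DIM('a))"
  have "(\<lambda>p. r - 1 / real (Suc p)) \<longlonglongrightarrow> r - 0"
    by (intro tendsto_intros LIMSEQ_Suc lim_1_over_n)
  then have lim: "(\<lambda>p. r - 1 / real (Suc p)) \<longlonglongrightarrow> r" by simp
  then have "(\<lambda>p. ?c * r ^ DIM('a) - ?c * (r - 1 / real (Suc p)) ^ DIM('a))
      \<longlonglongrightarrow> ?c * r ^ DIM('a) - ?c * r ^ DIM('a)"
    by (intro tendsto_intros)
  then have "\<forall>\<^sub>F p in sequentially. ?c * r ^ DIM('a) - ?c * (r - 1 / real (Suc p)) ^ DIM('a) < e / 3"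
    using e by (intro order_tendstoD) auto
  \<comment> \<open>The volume formula for the smaller ball is used with a nonnegative
    radius.\<close>
  moreover have "\<forall>\<^sub>F p in sequentially. 0 < r - 1 / real (Suc p)"
    using lim r by (rule order_tendstoD)
  ultimately obtain p where p: "?c * r ^ DIM('a) - ?c * (r - 1 / real (Suc p)) ^ DIM('a) < e / 3"
      "0 < r - 1 / real (Suc p)"
    by (metis (mono_tags, lifting) eventually_conj eventually_happens sequentially_bot)
  obtain q where q: "q \<in> D" "dist q x < 1 / real (Suc p)"
    using D closure_approachable[of x D] by (metis UNIV_I of_nat_0_less_iff zero_less_Suc zero_less_divide_1_iff)
  let ?B = "ball q (r - 1 / real (Suc p))"
  have sub: "?B \<subseteq> ball x r"
  proof
    fix y assume "y \<in> ?B"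
    then show "y \<in> ball x r" using q(2) dist_triangle[of x y q] by (simp add: dist_commute)
  qed
  have close: "\<bar>measure lborel (E k \<inter> ball x r) - measure lborel (E k \<inter> ?B)\<bar> < e / 3" for k
  proof -
    have [measurable]: "E k \<in> sets borel" by fact
    have fin: "emeasure lborel (E k \<inter> ball x r) \<noteq> \<infinity>" "emeasure lborel (ball x r) \<noteq> \<infinity>"
      using emeasure_bounded_finite[of "E k \<inter> ball x r"] emeasure_lborel_ball_finite[of x r]
      by (auto simp: bounded_Int)
    have "measure lborel (E k \<inter> ball x r) - measure lborel (E k \<inter> ?B)
        = measure lborel (E k \<inter> ball x r - E k \<inter> ?B)"
      by (rule measure_Diff[symmetric]) (use fin sub in auto)
    moreover have "\<dots> \<le> measure lborel (ball x r - ?B)"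
      by (rule measure_mono_fmeasurable)
        (auto intro!: fmeasurable_bounded_borel bounded_diff)
    moreover have "measure lborel (ball x r - ?B) = measure lborel (ball x r) - measure lborel ?B"
      by (rule measure_Diff) (use fin sub in auto)
    moreover have "\<dots> < e / 3" using p r by (simp add: content_ball)
    ultimately show ?thesis by simp
  qed
  have "Cauchy (\<lambda>k. measure lborel (E k \<inter> ?B))"
    using conv[OF q(1)] by (simp add: Cauchy_convergent_iff)
  then obtain N where N: "\<And>k l. k \<ge> N \<Longrightarrow> l \<ge> N \<Longrightarrow>
      dist (measure lborel (E k \<inter> ?B)) (measure lborel (E l \<inter> ?B)) < e / 3"
    using e unfolding Cauchy_def by (metis divide_pos_pos zero_less_numeral)
  have "dist (measure lborel (E k \<inter> ball x r)) (measure lborel (E l \<inter> ball x r)) < e"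
    if "k \<ge> N" "l \<ge> N" for k l
    using close[of k] close[of l] N[OF that] unfolding dist_real_def by linarith
  then show "\<exists>M. \<forall>m\<ge>M. \<forall>n\<ge>M. dist (measure lborel (E m \<inter> ball x r)) (measure lborel (E n \<inter> ball x r)) < e"
    by blast
qed

text \<open>At a small fixed scale the perimeter bound keeps each indicator uniformly close in L^1
  to its ball averages. The averages converge pointwise, hence in L^1 by domination, so the
  indicators are Cauchy.\<close>

lemma Cauchy_sets_of_bounded_perimeter:
  fixes E :: "nat \<Rightarrow> 'a::euclidean_space set"
  assumes E: "\<And>k. E k \<in> sets borel" "\<And>k. E k \<subseteq> cball 0 R" and P: "\<And>k. perimeter (E k) \<le> ereal P"
    and conv: "\<And>x m. convergent (\<lambda>k. measure lborel (E k \<inter> ball x (1 / real (Suc m))))"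
    and e: "e > 0"
  shows "\<exists>N. \<forall>k\<ge>N. \<forall>l\<ge>N. measure lborel (sym_diff (E k) (E l)) < e"
proof -
  have bE: "bounded (E k)" for k using E(2) bounded_cball bounded_subset by blast
  have [measurable]: "E k \<in> sets borel" for k by (rule E)
  have P0: "P \<ge> 0" using perimeter_nonneg[of "E 0"] P[of 0] by (metis ereal_less_eq(5) order_trans)
  \<comment> \<open>The scale r is chosen so that the two errors \<open>2 * r * P\<close>, one for
    each of the sets compared, together stay below \<open>e / 2\<close>.\<close>
  have "(\<lambda>m. 4 * (1 / real (Suc m)) * P) \<longlonglongrightarrow> 4 * 0 * P"
    by (intro tendsto_intros LIMSEQ_Suc lim_1_over_n)
  then have "\<forall>\<^sub>F m in sequentially. 4 * (1 / real (Suc m)) * P < e / 2"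
    using e by (intro order_tendstoD) auto
  then obtain m where m: "4 * (1 / real (Suc m)) * P < e / 2"
    by (metis (mono_tags, lifting) eventually_happens sequentially_bot)
  define r where "r = 1 / real (Suc m)"
  have r: "r > 0" by (simp add: r_def)
  define V where "V = measure lborel (ball (0::'a) r)"
  have V: "V > 0" using r by (simp add: V_def)
  define F where "F k x = measure lborel (E k \<inter> ball x r) / V" for k x
  define G where "G x = lim (\<lambda>k. F k x)" for x
  have FG: "(\<lambda>k. F k x) \<longlonglongrightarrow> G x" for x
  proof -
    have "convergent (\<lambda>k. F k x)"
      unfolding F_def using conv[of x m] convergent_mult_const_right_iff[of "1 / V"] V by (simp add: r_def)
    then show ?thesis by (simp add: G_def convergent_LIMSEQ_iff)
  qed
  have F01: "0 \<le> F k x" "F k x \<le> 1" for k x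
  proof -
    show "0 \<le> F k x" using V by (simp add: F_def)
    have "measure lborel (E k \<inter> ball x r) \<le> measure lborel (ball x r)"
      by (rule measure_mono_fmeasurable) (auto intro!: fmeasurable_bounded_borel)
    then show "F k x \<le> 1" using V by (simp add: F_def measure_lborel_ball_eq[of x] V_def)
  qed
  \<comment> \<open>All averages live on one ball, whose indicator is the integrable majorant for
    dominated convergence.\<close>
  have F0: "F k x = 0" if "x \<notin> cball 0 (R + r)" for k x
  proof -
    have "E k \<inter> ball x r = {}"
    proof (rule ccontr)
      assume "E k \<inter> ball x r \<noteq> {}"
      then obtain y where "y \<in> E k" "dist x y < r" by auto
      moreover have "norm y \<le> R" using E(2)[of k] \<open>y \<in> E k\<close> by auto
      ultimately show False using that norm_triangle_sub[of x y] by (simp add: dist_norm)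
    qed
    then show ?thesis by (simp add: F_def)
  qed
  have G01: "0 \<le> G x" "G x \<le> 1" for x
    using LIMSEQ_le_const[OF FG] LIMSEQ_le_const2[OF FG] F01 by blast+
  have G0: "G x = 0" if "x \<notin> cball 0 (R + r)" for x
    using FG[of x] F0[OF that] by (simp add: LIMSEQ_const_iff)
  have [measurable]: "F k \<in> borel_measurable borel" for k
  proof -
    have "(\<lambda>x. enn2real (emeasure lborel (E k \<inter> ball x r)) / V) \<in> borel_measurable borel"
      using borel_measurable_emeasure_Int_ball[OF E(1)] by measurable
    then show ?thesis by (simp add: F_def[abs_def] measure_def)
  qed
  have [measurable]: "G \<in> borel_measurable borel"
    by (rule borel_measurable_LIMSEQ_metric[of F]) (use FG in auto)
  have "(\<lambda>k. \<integral>\<^sup>+x. ennreal \<bar>F k x - G x\<bar> \<partial>lborel) \<longlonglongrightarrow> (\<integral>\<^sup>+x. 0 \<partial>(lborel::'a measure))"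
  proof (rule nn_integral_dominated_convergence[where w = "indicator (cball 0 (R + r))"])
    show "AE x in lborel. ennreal \<bar>F k x - G x\<bar> \<le> indicator (cball 0 (R + r)) x" for k
    proof (rule AE_I2)
      fix x
      have "\<bar>F k x - G x\<bar> \<le> 1" using F01[of k x] G01[of x] by simp
      moreover have "\<bar>F k x - G x\<bar> = 0" if "x \<notin> cball 0 (R + r)" using F0 G0 that by simp
      ultimately show "ennreal \<bar>F k x - G x\<bar> \<le> indicator (cball 0 (R + r)) x"
        by (cases "x \<in> cball 0 (R + r)") (simp_all add: indicator_def)
    qed
    show "indicator (cball 0 (R + r)) \<in> borel_measurable (lborel::'a measure)" by (rule borel_measurable_indicator) simp
    show "(\<integral>\<^sup>+x. indicator (cball 0 (R + r)) x \<partial>(lborel::'a measure)) < \<infinity>"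
      using emeasure_bounded_finite[OF bounded_cball, of "0::'a" "R + r"] by simp
    have "(\<lambda>k. ennreal \<bar>F k x - G x\<bar>) \<longlonglongrightarrow> ennreal 0" for x
      using tendsto_rabs[OF LIM_zero[OF FG[of x]]] by (intro tendsto_ennrealI) simp
    then show "AE x in lborel. (\<lambda>k. ennreal \<bar>F k x - G x\<bar>) \<longlonglongrightarrow> 0" by simp
  qed measurable
  then have "(\<lambda>k. \<integral>\<^sup>+x. ennreal \<bar>F k x - G x\<bar> \<partial>lborel) \<longlonglongrightarrow> 0" by simp
  then have "\<forall>\<^sub>F k in sequentially. (\<integral>\<^sup>+x. ennreal \<bar>F k x - G x\<bar> \<partial>lborel) < ennreal (e / 4)"
    using e by (intro order_tendstoD) auto
  then obtain N where N: "\<And>k. k \<ge> N \<Longrightarrow> (\<integral>\<^sup>+x. ennreal \<bar>F k x - G x\<bar> \<partial>lborel) < ennreal (e / 4)"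
    unfolding eventually_sequentially by blast
  have "measure lborel (sym_diff (E k) (E l)) < e" if "k \<ge> N" "l \<ge> N" for k l
  proof -
    have I: "(\<integral>\<^sup>+x. ennreal \<bar>indicat_real (E k) x - F k x\<bar> \<partial>lborel) \<le> ennreal (2 * r * P)" for k
      using integral_ball_average_diff_le_perimeter[OF E(1) bE P r] by (simp add: F_def V_def)
    let ?a = "\<lambda>k x. ennreal \<bar>indicat_real (E k) x - F k x\<bar>" and ?b = "\<lambda>k x. ennreal \<bar>F k x - G x\<bar>"
    have "emeasure lborel (sym_diff (E k) (E l)) = (\<integral>\<^sup>+x. indicator (sym_diff (E k) (E l)) x \<partial>lborel)"
      by (rule nn_integral_indicator[symmetric]) measurable
    also have "\<dots> \<le> (\<integral>\<^sup>+x. ((?a k x + ?b k x) + (?a l x + ?b l x)) \<partial>lborel)"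
    proof (rule nn_integral_mono)
      fix x
      have "indicator (sym_diff (E k) (E l)) x = ennreal \<bar>indicat_real (E k) x - indicat_real (E l) x\<bar>"
        by (auto simp: indicator_def)
      also have "\<dots> \<le> ennreal ((\<bar>indicat_real (E k) x - F k x\<bar> + \<bar>F k x - G x\<bar>)
            + (\<bar>indicat_real (E l) x - F l x\<bar> + \<bar>F l x - G x\<bar>))"
        by (intro ennreal_leI) linarith
      also have "\<dots> = (?a k x + ?b k x) + (?a l x + ?b l x)"
        by (simp add: ennreal_plus)
      finally show "indicator (sym_diff (E k) (E l)) x \<le> (?a k x + ?b k x) + (?a l x + ?b l x)" .
    qed
    also have "\<dots> = ((\<integral>\<^sup>+x. ?a k x \<partial>lborel) + (\<integral>\<^sup>+x. ?b k x \<partial>lborel))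
        + ((\<integral>\<^sup>+x. ?a l x \<partial>lborel) + (\<integral>\<^sup>+x. ?b l x \<partial>lborel))"
      by (rule trans[OF nn_integral_add arg_cong2[where f = "(+)", OF nn_integral_add nn_integral_add]])
        measurable
    also have "\<dots> \<le> (ennreal (2 * r * P) + ennreal (e / 4)) + (ennreal (2 * r * P) + ennreal (e / 4))"
      by (intro add_mono I less_imp_le N that)
    also have "\<dots> = ennreal (4 * r * P + e / 2)"
      using r P0 e by (simp flip: ennreal_plus)
    finally have "ennreal (measure lborel (sym_diff (E k) (E l))) \<le> ennreal (4 * r * P + e / 2)"
      using bE by (simp add: emeasure_lborel_bounded bounded_diff)
    then have "measure lborel (sym_diff (E k) (E l)) \<le> 4 * r * P + e / 2"
      using r P0 e by (subst (asm) ennreal_le_iff) auto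
    then show ?thesis using m by (simp add: r_def)
  qed
  then show ?thesis by blast
qed

lemma measure_sym_diff_triangle:
  fixes A B C :: "'a::euclidean_space set"
  assumes "A \<in> sets borel" "B \<in> sets borel" "C \<in> sets borel" "bounded A" "bounded B" "bounded C"
  shows "measure lborel (sym_diff A C) \<le> measure lborel (sym_diff A B) + measure lborel (sym_diff B C)"
proof -
  have "measure lborel (sym_diff A C) \<le> measure lborel (sym_diff A B \<union> sym_diff B C)"
    by (rule measure_mono_fmeasurable) (use assms in \<open>auto intro!: fmeasurable_bounded_borel bounded_diff\<close>)
  also have "\<dots> \<le> measure lborel (sym_diff A B) + measure lborel (sym_diff B C)"
    by (rule measure_Un_le) (use assms in auto)
  finally show ?thesis .
qed

text \<open>Completeness of the measure algebra. Along indices with summable successive distances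
  the upper limit of the sets is a limit in measure, by a Borel-Cantelli estimate; the Cauchy
  property then carries the whole sequence along.\<close>

lemma Cauchy_sets_convergent:
  fixes E :: "nat \<Rightarrow> 'a::euclidean_space set"
  assumes E: "\<And>k. E k \<in> sets borel" "\<And>k. E k \<subseteq> C" and C: "bounded C"
    and Cauchy: "\<And>e. e > 0 \<Longrightarrow> \<exists>N. \<forall>k\<ge>N. \<forall>l\<ge>N. measure lborel (sym_diff (E k) (E l)) < e"
  obtains L where "L \<in> sets borel" "L \<subseteq> C" "(\<lambda>k. measure lborel (sym_diff (E k) L)) \<longlonglongrightarrow> 0"
proof -
  have bE: "bounded (E k)" for k using E(2) C bounded_subset by blast
  have [measurable]: "E k \<in> sets borel" for k by (rule E)
  have "\<exists>N. \<forall>k\<ge>N. \<forall>l\<ge>N. measure lborel (sym_diff (E k) (E l)) < (1/2)^n" for n :: nat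
    by (rule Cauchy) simp
  then obtain N where N: "\<And>n k l. N n \<le> k \<Longrightarrow> N n \<le> l \<Longrightarrow> measure lborel (sym_diff (E k) (E l)) < (1/2)^n"
    by metis
  \<comment> \<open>The running maximum puts both \<open>s n\<close> and \<open>s (Suc n)\<close>
    beyond \<open>N n\<close>, so consecutive sets differ by less than 2^(-n).\<close>
  define s where "s n = (MAX i\<in>{..n}. N i)" for n
  have sN: "N n \<le> s n" "N n \<le> s (Suc n)" for n
    unfolding s_def by (intro Max_ge; auto)+
  define L where "L = (\<Inter>n. \<Union>m\<in>{n..}. E (s m))"
  have L: "L \<in> sets borel" unfolding L_def by measurable
  have LC: "L \<subseteq> C" unfolding L_def using E(2) by blast
  then have bL: "bounded L" using C bounded_subset by blast
  \<comment> \<open>A point outside all later consecutive differences never changes membership from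
    index n on, so it belongs to the upper limit \<open>L\<close> exactly when it belongs to
    \<open>E (s n)\<close>.\<close>
  have sub: "sym_diff (E (s n)) L \<subseteq> (\<Union>j. sym_diff (E (s (n + j))) (E (s (n + Suc j))))" (is "_ \<subseteq> ?U") for n
  proof (rule subsetI, rule ccontr)
    fix x assume x: "x \<in> sym_diff (E (s n)) L" "x \<notin> ?U"
    have const: "x \<in> E (s (n + j)) \<longleftrightarrow> x \<in> E (s n)" for j
    proof (induction j)
      case (Suc j)
      have "x \<notin> sym_diff (E (s (n + j))) (E (s (n + Suc j)))" using x(2) by blast
      with Suc show ?case by blast
    qed simp
    have "x \<in> L \<longleftrightarrow> x \<in> E (s n)"
    proof
      assume "x \<in> L"
      then obtain m where "m \<ge> n" "x \<in> E (s m)" unfolding L_def by blast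
      then show "x \<in> E (s n)" using const[of "m - n"] by simp
    next
      assume "x \<in> E (s n)"
      then have "x \<in> E (s (max k n))" for k using const[of "max k n - n"] by simp
      moreover have "max k n \<in> {k..}" for k by simp
      ultimately show "x \<in> L" unfolding L_def by blast
    qed
    with x(1) show False by blast
  qed
  have "emeasure lborel (sym_diff (E (s n)) L) \<le> ennreal (2 * (1/2)^n)" for n
  proof -
    have "emeasure lborel (sym_diff (E (s n)) L)
        \<le> emeasure lborel (\<Union>j. sym_diff (E (s (n + j))) (E (s (n + Suc j))))"
      by (rule emeasure_mono[OF sub]) measurable
    also have "\<dots> \<le> (\<Sum>j. emeasure lborel (sym_diff (E (s (n + j))) (E (s (n + Suc j)))))"
      by (rule emeasure_subadditive_countably) auto
    also have "\<dots> \<le> (\<Sum>j. ennreal ((1/2)^n * (1/2)^j))"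
    proof (intro suminf_le allI)
      fix j
      have "measure lborel (sym_diff (E (s (n + j))) (E (s (n + Suc j)))) \<le> (1/2)^(n + j)"
        using N[OF sN[of "n + j"]] by simp
      then show "emeasure lborel (sym_diff (E (s (n + j))) (E (s (n + Suc j)))) \<le> ennreal ((1/2)^n * (1/2)^j)"
        using bE by (simp add: emeasure_lborel_bounded bounded_diff power_add ennreal_leI)
    qed auto
    also have "\<dots> = ennreal (2 * (1/2)^n)"
      using sums_mult[OF geometric_sums[of "1/2::real"], of "(1/2)^n"]
      by (intro suminf_ennreal_eq) (auto simp: mult.commute)
    finally show ?thesis .
  qed
  then have near: "measure lborel (sym_diff (E (s n)) L) \<le> 2 * (1/2)^n" for n
    using bE bL by (simp add: emeasure_lborel_bounded bounded_diff)
  have "(\<lambda>k. measure lborel (sym_diff (E k) L)) \<longlonglongrightarrow> 0"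
  proof (rule LIMSEQ_I)
    fix e :: real assume e: "e > 0"
    have "(\<lambda>n. 3 * (1/2::real)^n) \<longlonglongrightarrow> 3 * 0"
      by (intro tendsto_intros LIMSEQ_power_zero) auto
    then have "\<forall>\<^sub>F n in sequentially. 3 * (1/2::real)^n < e"
      using e by (intro order_tendstoD) auto
    then obtain n where n: "3 * (1/2::real)^n < e"
      by (metis (mono_tags, lifting) eventually_happens sequentially_bot)
    have "measure lborel (sym_diff (E k) L) < e" if "k \<ge> s n" for k
      using measure_sym_diff_triangle[OF E(1) E(1) L bE bE bL, of k "s n"]
        N[of n k "s n"] near[of n] that sN(1)[of n] n by simp
    then show "\<exists>no. \<forall>k\<ge>no. norm (measure lborel (sym_diff (E k) L) - 0) < e"
      by auto
  qed
  with L LC show ?thesis using that by blast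
qed

section \<open>Semicontinuity, and sets of finite perimeter\<close>

text \<open>For a fixed test field the divergence is bounded, so its integral is continuous under
  convergence in measure; the perimeter is a supremum of such functionals. Upper bounds
  \<open>c k\<close> replace a lower limit so that ratio times volume can be inserted
  directly.\<close>

lemma perimeter_lower_semicontinuous:
  fixes E :: "nat \<Rightarrow> 'a::euclidean_space set"
  assumes E: "\<And>k. E k \<in> lmeasurable" and L: "L \<in> lmeasurable"
    and lim: "(\<lambda>k. vol (sym_diff (E k) L)) \<longlonglongrightarrow> 0"
    and P: "\<And>k. perimeter (E k) \<le> ereal (c k)" and c: "c \<longlonglongrightarrow> c0"
  shows "perimeter L \<le> ereal c0"
  unfolding perimeter_def
proof (rule SUP_least)
  fix \<phi> :: "'a \<Rightarrow> 'a" assume \<phi>: "\<phi> \<in> test_fields"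
  obtain B where B: "B > 0" "\<And>x. \<bar>divergence \<phi> x\<bar> \<le> B" "continuous_on UNIV (divergence \<phi>)"
    using divergence_continuous_bounded[OF \<phi>] by blast
  have [measurable]: "divergence \<phi> \<in> borel_measurable lebesgue"
    using B(3) by (intro measurable_completion) (simp add: borel_measurable_continuous_onI)
  have int: "integrable lebesgue (\<lambda>x. indicat_real S x * divergence \<phi> x)" if S: "S \<in> lmeasurable" for S
  proof (rule Bochner_Integration.integrable_bound)
    show "integrable lebesgue (\<lambda>x. indicat_real S x * B)"
      using S by (intro integrable_mult_left integrable_real_indicator) (auto simp: fmeasurable_def)
    show "(\<lambda>x. indicat_real S x * divergence \<phi> x) \<in> borel_measurable lebesgue"
      using S by measurable
    show "AE x in lebesgue. norm (indicat_real S x * divergence \<phi> x) \<le> norm (indicat_real S x * B)"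
      using B(1,2) by (auto split: split_indicator intro!: AE_I2 order_trans[OF _ abs_ge_self])
  qed
  have close: "\<bar>(LINT x:E k|lebesgue. divergence \<phi> x) - (LINT x:L|lebesgue. divergence \<phi> x)\<bar>
      \<le> B * vol (sym_diff (E k) L)" for k
  proof -
    have "(LINT x:E k|lebesgue. divergence \<phi> x) - (LINT x:L|lebesgue. divergence \<phi> x)
        = (LINT x|lebesgue. indicat_real (E k) x * divergence \<phi> x - indicat_real L x * divergence \<phi> x)"
      using Bochner_Integration.integral_diff[OF int[OF E[of k]] int[OF L]]
      by (simp add: set_lebesgue_integral_def)
    also have "\<bar>\<dots>\<bar> \<le> (LINT x|lebesgue. B * indicat_real (sym_diff (E k) L) x)"
    proof (rule order_trans[OF integral_abs_bound integral_mono])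
      show "integrable lebesgue (\<lambda>x. \<bar>indicat_real (E k) x * divergence \<phi> x - indicat_real L x * divergence \<phi> x\<bar>)"
        using int E L by (intro integrable_abs Bochner_Integration.integrable_diff) auto
      show "integrable lebesgue (\<lambda>x. B * indicat_real (sym_diff (E k) L) x)"
        using fmeasurable.Un[OF fmeasurable.Diff fmeasurable.Diff, OF E[of k] L L E[of k]]
        by (intro integrable_mult_right integrable_real_indicator) (auto simp: fmeasurable_def)
      show "\<bar>indicat_real (E k) x * divergence \<phi> x - indicat_real L x * divergence \<phi> x\<bar>
          \<le> B * indicat_real (sym_diff (E k) L) x" for x
        using B(1) B(2)[of x] by (auto simp: indicator_def)
    qed
    also have "\<dots> = B * vol (sym_diff (E k) L)"
      using E L by (simp add: fmeasurableD)
    finally show ?thesis .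
  qed
  have "(LINT x:L|lebesgue. divergence \<phi> x) \<le> c k + B * vol (sym_diff (E k) L)" for k
  proof -
    have "ereal (LINT x:E k|lebesgue. divergence \<phi> x) \<le> perimeter (E k)"
      unfolding perimeter_def by (rule SUP_upper[OF \<phi>])
    then have "(LINT x:E k|lebesgue. divergence \<phi> x) \<le> c k"
      using P[of k] by (metis ereal_less_eq(3) order_trans)
    with close[of k] show ?thesis by linarith
  qed
  moreover have "(\<lambda>k. c k + B * vol (sym_diff (E k) L)) \<longlonglongrightarrow> c0 + B * 0"
    by (intro tendsto_intros c lim)
  ultimately have "(LINT x:L|lebesgue. divergence \<phi> x) \<le> c0"
    using LIMSEQ_le_const by fastforce
  then show "ereal (LINT x:L|lebesgue. divergence \<phi> x) \<le> ereal c0" by simp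
qed

lemma perimeter_finite_real:
  assumes "perimeter E < \<infinity>"
  obtains c where "c \<ge> 0" "perimeter E = ereal c"
  using assms perimeter_nonneg[of E] by (cases "perimeter E") auto

text \<open>Lower semicontinuity along the constant sequence \<open>E\<close>, whose distance from
  \<open>L\<close> is 0.\<close>

lemma perimeter_null_sets_le:
  assumes "E \<in> lmeasurable" "L \<in> lmeasurable" "sym_diff E L \<in> null_sets lebesgue"
  shows "perimeter L \<le> perimeter E"
proof (cases "perimeter E < \<infinity>")
  case True
  then obtain c where "perimeter E = ereal c" using perimeter_finite_real by blast
  moreover have "vol (sym_diff E L) = 0" using assms(3) by (simp add: measure_def null_setsD1)
  ultimately show ?thesis
    using perimeter_lower_semicontinuous[of "\<lambda>_. E" L "\<lambda>_. c" c] assms by simp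
qed simp

section \<open>Balls and the existence of clusters\<close>

lemma perimeter_ball_finite:
  fixes x :: "'a::euclidean_space"
  assumes r: "r > 0"
  shows "perimeter (ball x r) < \<infinity>"
proof -
  let ?n = "DIM('a)"
  \<comment> \<open>\<open>H t\<close> bounds the increment of \<open>t \<mapsto> \<integral>\<psi>(y + t b)\<close> over the ball for \<open>t > 0\<close>, with equality at \<open>0\<close>,
    so \<open>D = H' 0\<close> bounds the derivative at \<open>0\<close>.\<close>
  define H where "H t = 2 * (unit_ball_vol (real ?n) * (r + t) ^ ?n - unit_ball_vol (real ?n) * r ^ ?n)" for t
  define D where "D = 2 * (unit_ball_vol (real ?n) * (real ?n * r ^ (?n - 1)))"
  have H: "(H has_real_derivative D) (at 0)"
    unfolding H_def[abs_def] D_def by (auto intro!: derivative_eq_intros)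
  \<comment> \<open>The first ball lies in \<open>ball z (r + t)\<close>, so the difference fits
    into an annulus. The factor 2 in \<open>H\<close> pays for the two halves of the symmetric
    difference.\<close>
  have half: "measure lborel (ball y r - ball z r) \<le> H t / 2" if "dist y z \<le> t" for y z :: 'a and t
  proof -
    have t0: "t \<ge> 0" using that zero_le_dist[of y z] by linarith
    have "ball y r \<subseteq> ball z (r + t)"
    proof
      fix u assume "u \<in> ball y r"
      then show "u \<in> ball z (r + t)" using that dist_triangle[of z u y] by (simp add: dist_commute)
    qed
    then have "measure lborel (ball y r - ball z r) \<le> measure lborel (ball z (r + t) - ball z r)"
      by (intro measure_mono_fmeasurable) (auto intro!: fmeasurable_bounded_borel bounded_diff)
    also have "\<dots> = measure lborel (ball z (r + t)) - measure lborel (ball z r)"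
      using emeasure_lborel_ball_finite[of z "r + t"] t0 by (intro measure_Diff) auto
    also have "\<dots> = H t / 2"
      using r t0 by (simp add: H_def content_ball)
    finally show ?thesis .
  qed
  \<comment> \<open>If the derivative of \<open>F\<close> at 0 exceeded \<open>D\<close>, then
    \<open>F - H\<close> would increase just to the right of 0, whereas the volume estimate gives
    \<open>F t - F 0 \<le> H t\<close> and \<open>H 0 = 0\<close>.\<close>
  have comp: "(LINT y:ball x r|lborel. g y \<bullet> b) \<le> D"
    if \<psi>: "C1c \<psi> g" and le: "\<And>y. \<bar>\<psi> y\<bar> \<le> 1" and b: "b \<in> Basis" for \<psi> g and b :: 'a
  proof (rule ccontr)
    assume neg: "\<not> ?thesis"
    define F where "F t = (LINT y:ball x r|lborel. \<psi> (y + t *\<^sub>R b))" for t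
    have "(F has_real_derivative (LINT y:ball x r|lborel. g y \<bullet> b)) (at 0)"
      unfolding F_def[abs_def]
      by (rule derivative_translated_integral[OF \<psi> le]) (use emeasure_lborel_ball_finite[of x r] in auto)
    from DERIV_diff[OF this H]
    have "((\<lambda>t. F t - H t) has_real_derivative (LINT y:ball x r|lborel. g y \<bullet> b) - D) (at 0)" .
    from DERIV_pos_inc_right[OF this] neg
    obtain d where d: "d > 0" "\<And>h. h > 0 \<Longrightarrow> h < d \<Longrightarrow> F 0 - H 0 < F h - H h" by auto
    define t where "t = d / 2"
    have t: "t > 0" "t < d" using d(1) by (auto simp: t_def)
    let ?A = "ball (x + t *\<^sub>R b) r" and ?B = "ball x r"
    have [measurable]: "\<psi> \<in> borel_measurable borel"
      using C1c_continuous[OF \<psi>] by (rule borel_measurable_continuous_onI)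
    have int: "integrable lborel (\<lambda>y. indicat_real (ball z r) y * \<psi> y)" for z
      using set_integrable_bounded_continuous[OF _ _ C1c_continuous[OF \<psi>] le, of "ball z r"]
        emeasure_lborel_ball_finite[of z r] by (simp add: set_integrable_def)
    have fin: "ball y r - ball z r \<in> fmeasurable lborel" for y z :: 'a
      by (auto intro!: fmeasurable_bounded_borel bounded_diff)
    have "F t = (LINT y|lborel. indicat_real ?A y * \<psi> y)"
    proof -
      have "(LINT y|lborel. indicat_real ?A y * \<psi> y)
          = (LINT y|lborel. indicat_real ?A (y + t *\<^sub>R b) * \<psi> (y + t *\<^sub>R b))"
        by (rule integral_lborel_translation[symmetric], rule borel_measurable_times) (auto intro!: borel_measurable_indicator)
      also have "\<dots> = F t"
        by (simp add: F_def set_lebesgue_integral_def indicator_def dist_norm)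
      finally show ?thesis ..
    qed
    moreover have "F 0 = (LINT y|lborel. indicat_real ?B y * \<psi> y)"
      by (simp add: F_def set_lebesgue_integral_def)
    ultimately have "F t - F 0 = (LINT y|lborel. indicat_real ?A y * \<psi> y - indicat_real ?B y * \<psi> y)"
      using Bochner_Integration.integral_diff[OF int int] by simp
    also have "\<dots> \<le> (LINT y|lborel. indicat_real (?A - ?B) y + indicat_real (?B - ?A) y)"
    proof (rule integral_mono)
      show "integrable lborel (\<lambda>y. indicat_real ?A y * \<psi> y - indicat_real ?B y * \<psi> y)"
        by (intro Bochner_Integration.integrable_diff int)
      show "integrable lborel (\<lambda>y. indicat_real (?A - ?B) y + indicat_real (?B - ?A) y)"
        using fin by (intro Bochner_Integration.integrable_add) (auto simp: fmeasurable_def)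
      show "indicat_real ?A y * \<psi> y - indicat_real ?B y * \<psi> y
          \<le> indicat_real (?A - ?B) y + indicat_real (?B - ?A) y" for y
        using le[of y] by (auto simp: indicator_def)
    qed
    also have "\<dots> = measure lborel (?A - ?B) + measure lborel (?B - ?A)"
      by (subst Bochner_Integration.integral_add) (use fin in \<open>auto simp: fmeasurable_def\<close>)
    also have "\<dots> \<le> H t / 2 + H t / 2"
      using b t by (intro add_mono half) (auto simp: dist_norm)
    finally have "F t - H t \<le> F 0 - H 0" by (simp add: H_def)
    with d(2)[OF t] show False by simp
  qed
  \<comment> \<open>Each component of a test field is bounded by 1, so \<open>comp\<close> applies
    to every coordinate; the resulting factor, the dimension, is crude but only finiteness
    matters.\<close>
  have "perimeter (ball x r) \<le> ereal (\<Sum>b\<in>(Basis::'a set). D)"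
    unfolding perimeter_borel[OF borel_open[OF open_ball]]
  proof (rule SUP_least)
    fix \<phi> :: "'a \<Rightarrow> 'a" assume \<phi>: "\<phi> \<in> test_fields"
    obtain G where G: "\<And>b. b \<in> Basis \<Longrightarrow> C1c (\<lambda>x. \<phi> x \<bullet> b) (G b)"
      "\<And>x. divergence \<phi> x = (\<Sum>b\<in>Basis. G b x \<bullet> b)"
      using test_field_components[OF \<phi>] by blast
    have le: "\<bar>\<phi> y \<bullet> b\<bar> \<le> 1" if "b \<in> Basis" for b y
    proof -
      have "norm (\<phi> y) \<le> 1" using \<phi> by (simp add: test_fields_def)
      then show ?thesis using Basis_le_norm[OF that, of "\<phi> y"] by linarith
    qed
    have int: "set_integrable lborel (ball x r) (\<lambda>y. G b y \<bullet> b)" if b: "b \<in> Basis" for b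
    proof -
      obtain B where B: "\<And>y. norm (G b y) \<le> B" using C1c_gradient_bounded[OF G(1)[OF b]] by blast
      show ?thesis
      proof (rule set_integrable_bounded_continuous)
        show "continuous_on UNIV (\<lambda>y. G b y \<bullet> b)"
          using G(1)[OF b] unfolding C1c_def by (auto intro!: continuous_intros)
        show "\<bar>G b y \<bullet> b\<bar> \<le> B" for y using Basis_le_norm[OF b, of "G b y"] B[of y] by linarith
      qed (use emeasure_lborel_ball_finite[of x r] in auto)
    qed
    have "(LINT y:ball x r|lborel. divergence \<phi> y) = (\<Sum>b\<in>Basis. LINT y:ball x r|lborel. G b y \<bullet> b)"
      unfolding G(2) set_lebesgue_integral_def scaleR_sum_right
      using int by (intro Bochner_Integration.integral_sum) (simp add: set_integrable_def)
    also have "\<dots> \<le> (\<Sum>b\<in>(Basis::'a set). D)"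
      by (intro sum_mono comp[OF G(1) le])
    finally show "ereal (LINT y:ball x r|lborel. divergence \<phi> y) \<le> ereal (\<Sum>b\<in>(Basis::'a set). D)"
      by simp
  qed
  then show ?thesis by (metis ereal_infty_less(1) less_ereal.simps(4) order_le_less_trans)
qed

text \<open>A non-empty open set is infinite, so it contains as many distinct points as there are
  chambers, and equal balls of small radius around them form a cluster. This is what keeps the
  infimum \<open>H_const\<close> finite.\<close>

lemma ex_Ncluster:
  fixes \<Omega> :: "'a::euclidean_space set"
  assumes "open \<Omega>" "\<Omega> \<noteq> {}"
  shows "\<exists>\<E> :: 'n::finite \<Rightarrow> 'a set. is_Ncluster \<Omega> \<E>"
proof -
  have "infinite \<Omega>" using assms finite_imp_not_open by blast
  then obtain T where T: "finite T" "card T = CARD('n)" "T \<subseteq> \<Omega>"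
    using infinite_arbitrarily_large by blast
  then obtain p :: "'n \<Rightarrow> 'a" where p: "bij_betw p UNIV T"
    using finite_same_card_bij[of "UNIV :: 'n set" T] by auto
  have "\<exists>e>0. ball (p i) e \<subseteq> \<Omega>" for i
    using assms(1) T(3) p open_contains_ball by (metis UNIV_I bij_betwE subsetD)
  then obtain e where e: "\<And>i. e i > 0" "\<And>i. ball (p i) (e i) \<subseteq> \<Omega>" by metis
  \<comment> \<open>The constraints on the common radius: fitting into \<Omega>, and half of each
    mutual distance. Including \<open>range e\<close> keeps the set non-empty even for a single
    chamber.\<close>
  define R where "R = range e \<union> (\<lambda>(i, j). dist (p i) (p j) / 2) ` {(i, j). i \<noteq> j}"
  define r where "r = Min R"
  have R: "finite R" "R \<noteq> {}" by (auto simp: R_def)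
  have "inj p" using p bij_betw_imp_inj_on by blast
  then have "\<forall>t\<in>R. t > 0" using e(1) by (auto simp: R_def inj_eq)
  then have r: "r > 0" unfolding r_def using R by simp
  have re: "r \<le> e i" for i unfolding r_def using R(1) by (intro Min_le) (auto simp: R_def)
  have rd: "r \<le> dist (p i) (p j) / 2" if "i \<noteq> j" for i j
    unfolding r_def using R(1) that by (intro Min_le) (auto simp: R_def)
  have disj: "ball (p i) r \<inter> ball (p j) r = {}" if "i \<noteq> j" for i j
  proof (rule ccontr)
    assume "ball (p i) r \<inter> ball (p j) r \<noteq> {}"
    then obtain z where "dist (p i) z < r" "dist (p j) z < r" by auto
    then show False using rd[OF that] dist_triangle2[of "p i" "p j" z] by linarith
  qed
  have "is_Ncluster \<Omega> (\<lambda>i. ball (p i) r)"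
    unfolding is_Ncluster_def is_Nset_def
  proof (intro conjI allI impI)
    show "ae_subset (ball (p i) r) \<Omega>" for i
    proof -
      have *: "ball (p i) r - \<Omega> = {}" using e(2)[of i] re[of i] subset_ball[of r "e i" "p i"] by blast
      show ?thesis unfolding ae_subset_def * by simp
    qed
    show "0 < vol (ball (p i) r)" for i using r by simp
    show "perimeter (ball (p i) r) < \<infinity>" for i by (rule perimeter_ball_finite[OF r])
  qed (use disj in auto)
  then show ?thesis by blast
qed

section \<open>Limits of clusters\<close>

text \<open>The Borel kernel given by the completion, cut off by the ball. The estimates above need
  genuine, not merely almost everywhere, containment in a bounded set.\<close>

lemma ex_borel_bounded_representative:
  fixes A :: "'a::euclidean_space set"
  assumes A: "A \<in> sets lebesgue" and sub: "ae_subset A (cball 0 R)"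
  obtains B where "B \<in> sets borel" "B \<subseteq> cball 0 R" "sym_diff A B \<in> null_sets lebesgue"
proof -
  obtain S N N' where S: "A = S \<union> N" "N \<subseteq> N'" "N' \<in> null_sets lborel" "S \<in> sets lborel"
    using A by (rule sets_completionE)
  have "N' \<union> (A - cball 0 R) \<in> null_sets lebesgue"
    using S(3) sub by (auto simp: ae_subset_def intro: null_sets_completionI)
  moreover have "sym_diff A (S \<inter> cball 0 R) \<subseteq> N' \<union> (A - cball 0 R)" using S by auto
  ultimately have "sym_diff A (S \<inter> cball 0 R) \<in> null_sets lebesgue"
    by (rule null_sets_completion_subset[rotated])
  moreover have "S \<inter> cball 0 R \<in> sets borel" using S(4) by auto
  ultimately show ?thesis using that by blast
qed

lemma lmeasurable_ae_subset_cball: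
  fixes A :: "'a::euclidean_space set"
  assumes "A \<in> sets lebesgue" "ae_subset A (cball 0 R)"
  shows "A \<in> lmeasurable"
proof -
  have "A \<inter> cball 0 R \<in> lmeasurable"
    using fmeasurable_Int_fmeasurable[OF lmeasurable_cball assms(1)] by (simp add: Int_commute)
  moreover have "A - cball 0 R \<in> lmeasurable"
    using assms(2) by (simp add: ae_subset_def fmeasurableI_null_sets)
  moreover have "A = (A \<inter> cball 0 R) \<union> (A - cball 0 R)" by blast
  ultimately show ?thesis using fmeasurable.Un[of "A \<inter> cball 0 R" lebesgue "A - cball 0 R"] by simp
qed

text \<open>Carries almost inclusion and almost disjointness to a limit: \<open>T k\<close> is built
  from symmetric differences with the limit sets, and \<open>N k\<close> collects the null
  exceptions at stage k.\<close>

lemma null_set_of_vanishing_cover: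
  fixes S :: "'a::euclidean_space set"
  assumes S: "S \<in> lmeasurable" and T: "\<And>k. T k \<in> lmeasurable" and N: "\<And>k. N k \<in> null_sets lebesgue"
    and sub: "\<And>k. S \<subseteq> T k \<union> N k" and lim: "(\<lambda>k. vol (T k)) \<longlonglongrightarrow> 0"
  shows "S \<in> null_sets lebesgue"
proof -
  have "vol S \<le> vol (T k)" for k
  proof -
    have "vol S \<le> vol (T k \<union> N k)"
      using S T[of k] N[of k] sub[of k]
      by (intro measure_mono_fmeasurable) (auto intro: fmeasurable.Un fmeasurableI_null_sets)
    also have "\<dots> = vol (T k)" using T[of k] N[of k] by (simp add: measure_Un_null_set)
    finally show ?thesis .
  qed
  then have "vol S \<le> 0" using lim LIMSEQ_le_const by blast
  then have "emeasure lebesgue S = 0"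
    using S by (simp add: emeasure_eq_measure2 measure_le_0_iff)
  then show ?thesis using S by (auto simp: null_sets_def)
qed

lemma vol_diff_le_sym_diff:
  fixes A B :: "'a::euclidean_space set"
  assumes "A \<in> lmeasurable" "B \<in> lmeasurable"
  shows "\<bar>vol A - vol B\<bar> \<le> vol (sym_diff A B)"
proof -
  have *: "vol X \<le> vol Y + vol (sym_diff X Y)" if "X \<in> lmeasurable" "Y \<in> lmeasurable" for X Y :: "'a set"
  proof -
    have "vol X \<le> vol (Y \<union> sym_diff X Y)"
      using that by (intro measure_mono_fmeasurable) (auto intro: fmeasurable.Un fmeasurable.Diff)
    also have "\<dots> \<le> vol Y + vol (sym_diff X Y)"
      using that by (intro measure_Un_le) (auto simp: fmeasurableD)
    finally show ?thesis .
  qed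
  show ?thesis using *[OF assms] *[OF assms(2,1)] by (simp add: Un_commute)
qed

lemma compactness_bounded_perimeter:
  fixes E :: "nat \<Rightarrow> 'n::finite \<Rightarrow> 'a::euclidean_space set"
  assumes E: "\<And>k i. E k i \<in> sets borel" "\<And>k i. E k i \<subseteq> cball 0 R"
    and P: "\<And>k i. perimeter (E k i) \<le> ereal P"
  shows "\<exists>(s :: nat \<Rightarrow> nat) L. strict_mono s \<and> (\<forall>i. L i \<in> sets borel \<and> L i \<subseteq> cball 0 R
      \<and> (\<lambda>k. measure lborel (sym_diff (E (s k) i) (L i))) \<longlonglongrightarrow> 0)"
proof -
  obtain D :: "'a set" where "countable D" "UNIV \<subseteq> closure D"
    by (rule separable)
  then have D: "countable D" "closure D = UNIV" by auto
  \<comment> \<open>The chamber index belongs to the countable index set, so one diagonal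
    subsequence serves all chambers. For \<open>p \<le> m\<close> the radius is not positive and the
    ball is empty, which is harmless.\<close>
  define f where "f k = (\<lambda>(q, m, p, i). measure lborel (E k i \<inter> ball q (1 / real (Suc m) - 1 / real (Suc p))))" for k
  have bd: "norm (f k x) \<le> measure lborel (cball (0::'a) R)" for k x
  proof -
    obtain q m p i where x: "x = (q, m, p, i)" by (cases x) auto
    have "measure lborel (E k i \<inter> ball q (1 / real (Suc m) - 1 / real (Suc p))) \<le> measure lborel (cball (0::'a) R)"
      using E(1)[of k i] E(2)[of k i]
      by (intro measure_mono_fmeasurable fmeasurable_bounded_borel) auto
    then show ?thesis by (simp add: f_def x)
  qed
  have "countable (D \<times> (UNIV :: (nat \<times> nat \<times> 'n) set))" using D(1) by auto
  then obtain s where s: "strict_mono (s :: nat \<Rightarrow> nat)"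
      "\<And>x. x \<in> D \<times> UNIV \<Longrightarrow> \<exists>l. (\<lambda>n. f (s n) x) \<longlonglongrightarrow> l"
    using function_convergent_subsequence[of "D \<times> UNIV" f "measure lborel (cball (0::'a) R)"] bd by blast
  have conv: "convergent (\<lambda>k. measure lborel (E (s k) i \<inter> ball x (1 / real (Suc m))))" for i x m
  proof (rule Cauchy_measure_Int_ball[OF _ _ D(2)])
    fix q p assume "q \<in> D"
    then show "convergent (\<lambda>k. measure lborel (E (s k) i \<inter> ball q (1 / real (Suc m) - 1 / real (Suc p))))"
      using s(2)[of "(q, m, p, i)"] by (auto simp: f_def convergent_def)
  qed (auto simp: E)
  have "\<exists>L. L \<in> sets borel \<and> L \<subseteq> cball 0 R \<and> (\<lambda>k. measure lborel (sym_diff (E (s k) i) L)) \<longlonglongrightarrow> 0" for i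
  proof -
    obtain L where "L \<in> sets borel" "L \<subseteq> cball 0 R" "(\<lambda>k. measure lborel (sym_diff (E (s k) i) L)) \<longlonglongrightarrow> 0"
    proof (rule Cauchy_sets_convergent[of "\<lambda>k. E (s k) i" "cball 0 R"])
      show "\<exists>N. \<forall>k\<ge>N. \<forall>l\<ge>N. measure lborel (sym_diff (E (s k) i) (E (s l) i)) < e" if "e > 0" for e
        by (rule Cauchy_sets_of_bounded_perimeter[OF E P conv that])
    qed (use E in auto)
    then show ?thesis by blast
  qed
  then have "\<exists>L. \<forall>i. L i \<in> sets borel \<and> L i \<subseteq> cball 0 R
      \<and> (\<lambda>k. measure lborel (sym_diff (E (s k) i) (L i))) \<longlonglongrightarrow> 0"
    by (intro choice allI)
  then obtain L where "\<forall>i. L i \<in> sets borel \<and> L i \<subseteq> cball 0 R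
      \<and> (\<lambda>k. measure lborel (sym_diff (E (s k) i) (L i))) \<longlonglongrightarrow> 0" ..
  with s(1) show ?thesis by (intro exI[of _ s] exI[of _ L] conjI)
qed

text \<open>Convergence of the bounds \<open>v k\<close> on the ratios gives one bound M for all of
  them. It keeps volumes away from 0 and perimeters bounded, so a subsequence of the chambers
  converges and the limit ratios stay below \<open>w\<close>. Measurability of \<open>F\<close>
  suffices, which allows \<open>F\<close> to be \<Omega> itself or a chamber of an arbitrary
  N-set.\<close>

lemma Ncluster_compactness:
  fixes E :: "nat \<Rightarrow> 'n::finite \<Rightarrow> 'a::euclidean_space set" and v :: "nat \<Rightarrow> real ^ 'n"
  assumes F: "F \<in> sets lebesgue" "ae_subset F (cball 0 R)"
    and E: "\<And>k. is_Nset F (E k)"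
    and P: "\<And>k i. perimeter (E k i) \<le> ereal (v k $ i * vol (E k i))"
    and v: "v \<longlonglongrightarrow> w"
  shows "\<exists>L. is_Ncluster F L \<and> (\<forall>i. perimeter (L i) \<le> ereal (w $ i * vol (L i)))"
proof -
  have Es: "E k i \<in> sets lebesgue" "ae_subset (E k i) F" "vol (E k i) > 0" for k i
    using E[of k] unfolding is_Nset_def by auto
  have EC: "ae_subset (E k i) (cball 0 R)" for k i
  proof -
    have "(E k i - F) \<union> (F - cball 0 R) \<in> null_sets lebesgue"
      using Es(2)[of k i] F(2) by (simp add: ae_subset_def null_sets.Un)
    then show ?thesis unfolding ae_subset_def
      by (rule null_sets_completion_subset[rotated]) auto
  qed
  have Em: "E k i \<in> lmeasurable" for k i using lmeasurable_ae_subset_cball[OF Es(1) EC] .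
  have "\<exists>B. B \<in> sets borel \<and> B \<subseteq> cball 0 R \<and> sym_diff (E k i) B \<in> null_sets lebesgue" for k i
    using ex_borel_bounded_representative[OF Es(1) EC] by metis
  then obtain B where B: "\<And>k i. B k i \<in> sets borel" "\<And>k i. B k i \<subseteq> cball 0 R"
      "\<And>k i. sym_diff (E k i) (B k i) \<in> null_sets lebesgue" by metis
  have bB: "bounded (B k i)" for k i using B(2) bounded_cball bounded_subset by blast
  have Bm: "B k i \<in> lmeasurable" for k i
    using B(1) bB by (intro bounded_set_imp_lmeasurable) (auto intro: sets_completionI_sets)
  have volB: "vol (B k i) = vol (E k i)" for k i
  proof -
    have "vol (sym_diff (E k i) (B k i)) = 0" using B(3)[of k i] by (simp add: measure_def null_setsD1)
    then show ?thesis using vol_diff_le_sym_diff[OF Em[of k i] Bm[of k i]] by simp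
  qed
  obtain M where M: "M > 0" "\<And>k i. v k $ i \<le> M"
  proof -
    have "bounded (range v)" using v convergent_imp_bounded by blast
    then obtain M where M: "M > 0" "\<And>k. norm (v k) \<le> M" unfolding bounded_pos by auto
    have "v k $ i \<le> M" for k i using M(2)[of k] component_le_norm_cart[of "v k" i] by linarith
    with M(1) show ?thesis using that by blast
  qed
  have PB: "perimeter (B k i) \<le> ereal (v k $ i * vol (B k i))" for k i
    using perimeter_null_sets_le[OF Em Bm B(3)] P[of k i] volB[of k i] by (metis order_trans)
  have PM: "perimeter (B k i) \<le> ereal (M * measure lborel (B k i))" for k i
  proof -
    have "v k $ i * vol (B k i) \<le> M * measure lborel (B k i)"
      using M(2)[of k i] B(1)[of k i] by (simp add: mult_right_mono)
    then show ?thesis using PB[of k i] by (metis ereal_less_eq(3) order_trans)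
  qed
  define c where "c = measure lborel (ball (0::'a) (1 / (2 * M))) / 2"
  have c: "c > 0" using M by (simp add: c_def)
  \<comment> \<open>This bound is uniform in k, so it survives the limit and no limit chamber is
    null.\<close>
  have lower: "c \<le> vol (B k i)" for k i
    using volume_lower_bound[OF B(1) bB M(1) _ PM, of k i] Es(3)[of k i] volB[of k i] B(1)[of k i]
    by (simp add: c_def)
  have upper: "perimeter (B k i) \<le> ereal (M * measure lborel (cball (0::'a) R))" for k i
  proof -
    have "measure lborel (B k i) \<le> measure lborel (cball (0::'a) R)"
      using B(1)[of k i] B(2)[of k i] by (intro measure_mono_fmeasurable fmeasurable_bounded_borel) auto
    then have "M * measure lborel (B k i) \<le> M * measure lborel (cball (0::'a) R)" using M(1) by simp
    then show ?thesis using PM[of k i] by (metis ereal_less_eq(3) order_trans)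
  qed
  obtain s L where s: "strict_mono (s :: nat \<Rightarrow> nat)"
    and sL: "\<forall>i. L i \<in> sets borel \<and> L i \<subseteq> cball 0 R
      \<and> (\<lambda>k. measure lborel (sym_diff (B (s k) i) (L i))) \<longlonglongrightarrow> 0"
    using compactness_bounded_perimeter[where E = B, OF B(1,2) upper] by (elim exE conjE)
  have L: "L i \<in> sets borel" "L i \<subseteq> cball 0 R"
    and lim: "(\<lambda>k. measure lborel (sym_diff (B (s k) i) (L i))) \<longlonglongrightarrow> 0" for i
    by (simp_all only: sL)
  have Ls: "L i \<in> sets lebesgue" for i using L(1) by (simp add: sets_completionI_sets)
  have Lm: "L i \<in> lmeasurable" for i
    using Ls L(2)[of i] by (intro bounded_set_imp_lmeasurable) (auto intro: bounded_subset[OF bounded_cball])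
  have lim': "(\<lambda>k. vol (sym_diff (B (s k) i) (L i))) \<longlonglongrightarrow> 0" for i
  proof -
    have "vol (sym_diff (B (s k) i) (L i)) = measure lborel (sym_diff (B (s k) i) (L i))" for k
      using B(1) L(1) by (intro measure_completion) auto
    then show ?thesis using lim by simp
  qed
  have limvol: "(\<lambda>k. vol (B (s k) i)) \<longlonglongrightarrow> vol (L i)" for i
  proof (rule Lim_transform)
    show "(\<lambda>k. vol (L i)) \<longlonglongrightarrow> vol (L i)" by simp
    show "(\<lambda>k. vol (B (s k) i) - vol (L i)) \<longlonglongrightarrow> 0"
      by (rule Lim_null_comparison[OF _ lim'[of i]])
        (use vol_diff_le_sym_diff[OF Bm Lm] in auto)
  qed
  \<comment> \<open>Semicontinuity is applied to the products of ratio bound and volume: both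
    factors converge, hence so do the upper bounds for the perimeters.\<close>
  have per: "perimeter (L i) \<le> ereal (w $ i * vol (L i))" for i
  proof (rule perimeter_lower_semicontinuous[OF Bm Lm lim' PB])
    have "(\<lambda>k. v (s k) $ i) \<longlonglongrightarrow> w $ i"
      using LIMSEQ_subseq_LIMSEQ[OF v s] by (intro tendsto_vec_nth) (simp add: comp_def)
    then show "(\<lambda>k. v (s k) $ i * vol (B (s k) i)) \<longlonglongrightarrow> w $ i * vol (L i)"
      by (intro tendsto_mult limvol)
  qed
  have symm: "sym_diff (B k i) (L i) \<in> lmeasurable" for k i
    using Bm Lm by (intro fmeasurable.Un fmeasurable.Diff)
  have "is_Ncluster F L"
    unfolding is_Ncluster_def is_Nset_def
  proof (intro conjI allI impI)
    show "L i \<in> sets lebesgue" for i by (rule Ls)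
    show "ae_subset (L i) F" for i
      unfolding ae_subset_def
    proof (rule null_set_of_vanishing_cover[OF _ symm _ _ lim'])
      show "L i - F \<in> lmeasurable" using Lm[of i] F(1) by (rule fmeasurable_Diff)
      show "sym_diff (E (s k) i) (B (s k) i) \<union> (E (s k) i - F) \<in> null_sets lebesgue" for k
        using B(3) Es(2) by (simp add: ae_subset_def null_sets.Un)
      show "L i - F \<subseteq> sym_diff (B (s k) i) (L i) \<union> (sym_diff (E (s k) i) (B (s k) i) \<union> (E (s k) i - F))" for k
        by blast
    qed
    have "c \<le> vol (L i)" for i
      using lower by (intro LIMSEQ_le_const[OF limvol]) auto
    then show "0 < vol (L i)" for i using c by (meson less_le_trans)
    show "perimeter (L i) < \<infinity>" for i using per[of i] by (metis ereal_infty_less(1) less_ereal.simps(4) order_le_less_trans)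
    fix i j :: 'n assume ij: "i \<noteq> j"
    show "L i \<inter> L j \<in> null_sets lebesgue"
    proof (rule null_set_of_vanishing_cover)
      show "L i \<inter> L j \<in> lmeasurable" using Lm by (rule fmeasurable.Int) (rule Lm)
      show "sym_diff (B (s k) i) (L i) \<union> sym_diff (B (s k) j) (L j) \<in> lmeasurable" for k
        by (rule fmeasurable.Un[OF symm symm])
      show "sym_diff (E (s k) i) (B (s k) i) \<union> sym_diff (E (s k) j) (B (s k) j) \<union> (E (s k) i \<inter> E (s k) j)
          \<in> null_sets lebesgue" for k
        using E[of "s k"] ij by (intro null_sets.Un[OF null_sets.Un[OF B(3) B(3)]]) (simp add: is_Nset_def)
      show "L i \<inter> L j \<subseteq> (sym_diff (B (s k) i) (L i) \<union> sym_diff (B (s k) j) (L j)) \<union>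
          (sym_diff (E (s k) i) (B (s k) i) \<union> sym_diff (E (s k) j) (B (s k) j) \<union> (E (s k) i \<inter> E (s k) j))" for k
        by blast
      have sum0: "(\<lambda>k. vol (sym_diff (B (s k) i) (L i)) + vol (sym_diff (B (s k) j) (L j))) \<longlonglongrightarrow> 0"
        using tendsto_add[OF lim'[of i] lim'[of j]] by simp
      have le: "norm (vol (sym_diff (B (s k) i) (L i) \<union> sym_diff (B (s k) j) (L j)))
          \<le> vol (sym_diff (B (s k) i) (L i)) + vol (sym_diff (B (s k) j) (L j))" for k
        using measure_Un_le[OF fmeasurableD[OF symm] fmeasurableD[OF symm]] by simp
      show "(\<lambda>k. vol (sym_diff (B (s k) i) (L i) \<union> sym_diff (B (s k) j) (L j))) \<longlonglongrightarrow> 0"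
        by (rule Lim_null_comparison[OF always_eventually sum0]) (rule allI, rule le)
    qed
  qed
  with per show ?thesis by (intro exI[of _ L] conjI allI)
qed

section \<open>Cheeger sets and the two minimisation problems\<close>

lemma cheeger_const_nonneg: "0 \<le> cheeger_const (F :: 'a::euclidean_space set)"
  unfolding cheeger_const_def
proof (rule INF_greatest, clarify)
  fix E :: "'a set" assume "0 < vol E"
  then show "0 \<le> perimeter E / ereal (vol E)"
    using perimeter_nonneg[of E] by (cases "perimeter E") auto
qed

text \<open>The bounds h + 1/(k+1) on a minimising sequence converge to h, so the compactness of
  clusters applies. Finite perimeter is recorded because these sets will replace the chambers of an
  N-set and must form a cluster.\<close>

lemma ex_Cheeger_set:
  fixes F :: "'a::euclidean_space set"
  assumes F: "F \<in> sets lebesgue" "ae_subset F (cball 0 R)" and fin: "cheeger_const F < \<infinity>"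
  obtains C where "C \<in> sets lebesgue" "ae_subset C F" "vol C > 0" "perimeter C < \<infinity>"
    "perimeter C / ereal (vol C) = cheeger_const F"
proof -
  let ?A = "{E. E \<in> sets lebesgue \<and> ae_subset E F \<and> vol E > 0}"
  obtain h where h: "cheeger_const F = ereal h"
    using fin cheeger_const_nonneg[of F] by (cases "cheeger_const F") auto
  have "\<exists>C. C \<in> ?A \<and> perimeter C / ereal (vol C) < ereal (h + 1 / real (Suc k))" for k
  proof -
    have "cheeger_const F < ereal (h + 1 / real (Suc k))" by (simp add: h)
    then show ?thesis unfolding cheeger_const_def INF_less_iff by blast
  qed
  then have "\<exists>C. \<forall>k. C k \<in> ?A \<and> perimeter (C k) / ereal (vol (C k)) < ereal (h + 1 / real (Suc k))"
    by (intro choice allI)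
  then obtain C where
    sC: "\<forall>k. C k \<in> ?A \<and> perimeter (C k) / ereal (vol (C k)) < ereal (h + 1 / real (Suc k))" ..
  have C: "C k \<in> ?A" "perimeter (C k) / ereal (vol (C k)) < ereal (h + 1 / real (Suc k))" for k
    using sC[rule_format, of k] by blast+
  \<comment> \<open>A single set is a cluster indexed by \<open>unit\<close>.\<close>
  define v :: "nat \<Rightarrow> real ^ unit" where "v k = (\<chi> i. h + 1 / real (Suc k))" for k
  have "(\<lambda>k. h + 1 / real (Suc k)) \<longlonglongrightarrow> h + 0"
    by (intro tendsto_intros LIMSEQ_Suc lim_1_over_n)
  then have v: "v \<longlonglongrightarrow> (\<chi> i. h)"
    unfolding v_def by (intro vec_tendstoI) simp
  have N: "is_Nset F (\<lambda>_::unit. C k)" for k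
    using C(1)[of k] by (simp add: is_Nset_def)
  have P: "perimeter (C k) \<le> ereal (v k $ i * vol (C k))" for k i
    using C[of k] perimeter_nonneg[of "C k"]
    by (cases "perimeter (C k)") (auto simp: v_def divide_less_eq)
  obtain L where L: "is_Ncluster F L" "\<forall>i :: unit. perimeter (L i) \<le> ereal ((\<chi> i. h) $ i * vol (L i))"
    using Ncluster_compactness[OF F N P v] by blast
  have L': "L () \<in> ?A" "perimeter (L ()) < \<infinity>" "perimeter (L ()) \<le> ereal (h * vol (L ()))"
    using L(1) L(2)[rule_format, of "()"] unfolding is_Ncluster_def is_Nset_def by auto
  have "cheeger_const F \<le> perimeter (L ()) / ereal (vol (L ()))"
    unfolding cheeger_const_def by (rule INF_lower[OF L'(1)])
  moreover have "perimeter (L ()) / ereal (vol (L ())) \<le> ereal h"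
    using L' perimeter_nonneg[of "L ()"]
    by (cases "perimeter (L ())") (auto simp: divide_le_eq)
  ultimately show ?thesis using L' h that[of "L ()"] by auto
qed

text \<open>Finite perimeters make \<open>real_of_ereal\<close> lossless; the product form of the
  first claim matches the hypothesis of \<open>Ncluster_compactness\<close>.\<close>

lemma Ncluster_ratios:
  assumes "is_Ncluster F \<E>"
  shows "perimeter (\<E> i) = ereal (real_of_ereal (perimeter (\<E> i)) / vol (\<E> i) * vol (\<E> i))"
    and "(\<chi> i. real_of_ereal (perimeter (\<E> i)) / vol (\<E> i)) \<in> nonneg_orthant"
proof -
  have fin: "perimeter (\<E> i) < \<infinity>" "vol (\<E> i) > 0" for i
    using assms unfolding is_Ncluster_def is_Nset_def by auto
  obtain c where "perimeter (\<E> i) = ereal c" using perimeter_finite_real[OF fin(1)] by metis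
  then show "perimeter (\<E> i) = ereal (real_of_ereal (perimeter (\<E> i)) / vol (\<E> i) * vol (\<E> i))"
    using fin(2)[of i] by simp
  show "(\<chi> i. real_of_ereal (perimeter (\<E> i)) / vol (\<E> i)) \<in> nonneg_orthant"
    using real_of_ereal_pos[OF perimeter_nonneg] fin(2)
    by (auto simp: nonneg_orthant_def intro!: divide_nonneg_pos)
qed

theorem mainTheorem5:
  fixes \<Omega> :: "'a::euclidean_space set"
    and \<Phi> :: "real^'n::finite \<Rightarrow> real"
  assumes "open \<Omega>" and "bounded \<Omega>" and "\<Omega> \<noteq> {}"
    and Phi_nonneg: "\<forall>v\<in>nonneg_orthant. 0 \<le> \<Phi> v"
    and Phi1: "lsc_on nonneg_orthant \<Phi>"
    and Phi2: "\<exists>\<delta>>0. \<forall>v\<in>nonneg_orthant. \<Phi> v \<ge> \<delta> * (\<Sum>i\<in>UNIV. v $ i)"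
    and Phi3: "\<forall>v\<in>nonneg_orthant. \<forall>w\<in>nonneg_orthant.
                 (\<forall>i. v $ i \<le> w $ i) \<longrightarrow> \<Phi> v \<le> \<Phi> w"
  shows "(\<exists>\<E> :: 'n \<Rightarrow> 'a set. is_Ncluster \<Omega> \<E>
            \<and> ereal (H_value \<Phi> \<E>) = H_const \<Phi> \<Omega>)
       \<and> (\<exists>\<E> :: 'n \<Rightarrow> 'a set. is_Ncluster \<Omega> \<E>
            \<and> L_value \<Phi> \<E> = L_const \<Phi> \<Omega>)"
proof -
  define ratio where "ratio \<E> = (\<chi> i. real_of_ereal (perimeter (\<E> i)) / vol (\<E> i))"
    for \<E> :: "'n \<Rightarrow> 'a set"
  have HV: "H_value \<Phi> \<E> = \<Phi> (ratio \<E>)" for \<E> :: "'n \<Rightarrow> 'a set"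
    by (simp add: H_value_def ratio_def)
  have orth: "ratio \<E> \<in> nonneg_orthant" if "is_Ncluster \<Omega> \<E>" for \<E>
    using Ncluster_ratios(2)[OF that] by (simp add: ratio_def)
  have H_le: "H_const \<Phi> \<Omega> \<le> ereal (H_value \<Phi> \<E>)" if "is_Ncluster \<Omega> \<E>" for \<E> :: "'n \<Rightarrow> 'a set"
    unfolding H_const_def by (rule INF_lower) (simp add: that)
  have \<Omega>s: "\<Omega> \<in> sets lebesgue" using assms(1) by simp
  obtain R where "\<Omega> \<subseteq> cball 0 R" using assms(2) unfolding bounded_iff by (auto simp: subset_iff)
  then have \<Omega>0: "\<Omega> - cball 0 R = {}" by blast
  have \<Omega>R: "ae_subset \<Omega> (cball 0 R)" unfolding ae_subset_def \<Omega>0 by simp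
  obtain \<E>0 :: "'n \<Rightarrow> 'a set" where "is_Ncluster \<Omega> \<E>0" using ex_Ncluster[OF assms(1,3)] by blast
  then have "H_const \<Phi> \<Omega> < \<infinity>" using H_le[of \<E>0] by (cases "H_const \<Phi> \<Omega>") auto
  moreover have "0 \<le> H_const \<Phi> \<Omega>"
    unfolding H_const_def by (rule INF_greatest) (use Phi_nonneg orth in \<open>auto simp: HV\<close>)
  ultimately obtain h where h: "H_const \<Phi> \<Omega> = ereal h" "h \<ge> 0"
    by (cases "H_const \<Phi> \<Omega>") auto
  have "\<exists>E :: 'n \<Rightarrow> 'a set. is_Ncluster \<Omega> E \<and> H_value \<Phi> E < h + 1 / real (Suc k)" for k
  proof -
    have "H_const \<Phi> \<Omega> < ereal (h + 1 / real (Suc k))" by (simp add: h)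
    then show ?thesis unfolding H_const_def INF_less_iff by auto
  qed
  then have "\<exists>E :: nat \<Rightarrow> 'n \<Rightarrow> 'a set. \<forall>k. is_Ncluster \<Omega> (E k) \<and> H_value \<Phi> (E k) < h + 1 / real (Suc k)"
    by (intro choice allI)
  then obtain E :: "nat \<Rightarrow> 'n \<Rightarrow> 'a set"
    where sE: "\<forall>k. is_Ncluster \<Omega> (E k) \<and> H_value \<Phi> (E k) < h + 1 / real (Suc k)" ..
  have E: "is_Ncluster \<Omega> (E k)" "\<Phi> (ratio (E k)) < h + 1 / real (Suc k)" for k
    using sE[rule_format, of k] by (simp_all add: HV)
  \<comment> \<open>Coercivity: ratios are nonnegative, so their sum is the l^1 norm, which
    (\<Phi>.2) bounds by \<Phi>/\<delta>; the values of \<Phi> stay below h + 1.\<close>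
  have "bounded (range (\<lambda>k. ratio (E k)))"
  proof -
    obtain \<delta> where \<delta>: "\<delta> > 0" "\<And>v. v \<in> nonneg_orthant \<Longrightarrow> \<delta> * (\<Sum>i\<in>UNIV. v $ i) \<le> \<Phi> v"
      using Phi2 by blast
    have "norm (ratio (E k)) \<le> (h + 1) / \<delta>" for k
    proof -
      have nn: "0 \<le> ratio (E k) $ i" for i using orth[OF E(1)] by (simp add: nonneg_orthant_def)
      have "norm (ratio (E k)) \<le> (\<Sum>i\<in>UNIV. ratio (E k) $ i)"
        using norm_le_l1_cart[of "ratio (E k)"] nn by simp
      also have "\<dots> \<le> (h + 1) / \<delta>"
      proof -
        have "1 / real (Suc k) \<le> 1" by simp
        then have "\<delta> * (\<Sum>i\<in>UNIV. ratio (E k) $ i) \<le> h + 1"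
          using \<delta>(2)[OF orth[OF E(1)], of k] E(2)[of k] by linarith
        then show ?thesis using \<delta>(1) by (simp add: field_simps)
      qed
      finally show ?thesis .
    qed
    then show ?thesis unfolding bounded_iff by auto
  qed
  then obtain w s where s: "strict_mono (s :: nat \<Rightarrow> nat)" and w: "(\<lambda>k. ratio (E (s k))) \<longlonglongrightarrow> w"
    using bounded_imp_convergent_subsequence[of "\<lambda>k. ratio (E k)"] by (auto simp: comp_def)
  have w_orth: "w \<in> nonneg_orthant"
    unfolding nonneg_orthant_def
  proof (intro CollectI allI)
    fix i
    show "0 \<le> w $ i"
      by (rule LIMSEQ_le_const[OF tendsto_vec_nth[OF w]])
        (use orth[OF E(1)] in \<open>auto simp: nonneg_orthant_def\<close>)
  qed
  have "\<Phi> w \<le> h"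
  proof (rule ccontr)
    \<comment> \<open>A level t strictly between h and \<open>\<Phi> w\<close> would by
      semicontinuity lie below \<Phi> at the ratios of late clusters, although those values tend to
      at most h.\<close>
    assume "\<not> \<Phi> w \<le> h"
    define t where "t = (h + \<Phi> w) / 2"
    have t: "h < t" "t < \<Phi> w" using \<open>\<not> \<Phi> w \<le> h\<close> by (auto simp: t_def)
    obtain U where U: "open U" "w \<in> U" "\<forall>y\<in>U \<inter> nonneg_orthant. t < \<Phi> y"
      using Phi1 w_orth t(2) unfolding lsc_on_def by blast
    have "\<forall>\<^sub>F k in sequentially. ratio (E (s k)) \<in> U"
      using w U(1,2) by (rule topological_tendstoD)
    moreover have "(\<lambda>k. h + 1 / real (Suc (s k))) \<longlonglongrightarrow> h + 0"
      using LIMSEQ_subseq_LIMSEQ[OF LIMSEQ_Suc[OF lim_1_over_n] s]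
      by (intro tendsto_add tendsto_const) (simp add: comp_def)
    then have "\<forall>\<^sub>F k in sequentially. h + 1 / real (Suc (s k)) < t"
      using t(1) by (intro order_tendstoD(2)[where y = "h + 0"]) auto
    ultimately have "\<forall>\<^sub>F k in sequentially. False"
    proof eventually_elim
      case (elim k)
      have "t < \<Phi> (ratio (E (s k)))" using U(3) elim(1) orth[OF E(1)] by blast
      with E(2)[of "s k"] elim(2) show False by linarith
    qed
    then show False by simp
  qed
  have Nset: "is_Nset \<Omega> (E (s k))" for k using E(1)[of "s k"] by (simp add: is_Ncluster_def)
  have Eper: "perimeter (E (s k) i) \<le> ereal (ratio (E (s k)) $ i * vol (E (s k) i))" for k i
    using Ncluster_ratios(1)[OF E(1)[of "s k"], of i] by (simp add: ratio_def)
  obtain L where L: "is_Ncluster \<Omega> L" "\<forall>i. perimeter (L i) \<le> ereal (w $ i * vol (L i))"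
    using Ncluster_compactness[OF \<Omega>s \<Omega>R Nset Eper w] by blast
  have "ratio L $ i \<le> w $ i" for i
  proof -
    have "vol (L i) > 0" using L(1) by (simp add: is_Ncluster_def is_Nset_def)
    moreover have "ereal (ratio L $ i * vol (L i)) \<le> ereal (w $ i * vol (L i))"
      using Ncluster_ratios(1)[OF L(1), of i] L(2)[rule_format, of i] by (simp add: ratio_def)
    ultimately show ?thesis by simp
  qed
  then have "\<Phi> (ratio L) \<le> \<Phi> w" using Phi3 orth[OF L(1)] w_orth by blast
  then have HL: "ereal (H_value \<Phi> L) = H_const \<Phi> \<Omega>"
    using H_le[OF L(1)] \<open>\<Phi> w \<le> h\<close> h(1) by (simp add: HV)
  \<comment> \<open>Each chamber competes in its own Cheeger constant, so h(L_i) is at most the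
    ratio of L_i, and monotonicity of \<Phi> applies.\<close>
  have "L_value \<Phi> L \<le> ereal (H_value \<Phi> L)"
  proof -
    have *: "0 \<le> cheeger_const (L i)" "cheeger_const (L i) \<le> ereal (ratio L $ i)" for i
    proof -
      show "0 \<le> cheeger_const (L i)" by (rule cheeger_const_nonneg)
      have Li: "L i \<in> sets lebesgue" "vol (L i) > 0" using L(1) by (auto simp: is_Ncluster_def is_Nset_def)
      then have "cheeger_const (L i) \<le> perimeter (L i) / ereal (vol (L i))"
        unfolding cheeger_const_def by (intro INF_lower) (simp add: ae_subset_def)
      also have "\<dots> = ereal (ratio L $ i)"
        using Li(2) by (subst Ncluster_ratios(1)[OF L(1)]) (simp add: ratio_def)
      finally show "cheeger_const (L i) \<le> ereal (ratio L $ i)" .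
    qed
    then have fin: "cheeger_const (L i) < \<infinity>" for i
      by (metis ereal_infty_less(1) less_ereal.simps(4) order_le_less_trans)
    define u where "u = (\<chi> i. real_of_ereal (cheeger_const (L i)))"
    have "u $ i \<le> ratio L $ i" for i
      using *[of i] by (cases "cheeger_const (L i)") (auto simp: u_def)
    moreover have "u \<in> nonneg_orthant"
      using *(1) real_of_ereal_pos by (auto simp: u_def nonneg_orthant_def)
    ultimately have "\<Phi> u \<le> \<Phi> (ratio L)" using Phi3 orth[OF L(1)] by blast
    then show ?thesis using fin by (simp add: L_value_def HV u_def)
  qed
  moreover have "H_const \<Phi> \<Omega> \<le> L_const \<Phi> \<Omega>"
    unfolding L_const_def
  proof (rule INF_greatest, clarify)
    fix \<E> :: "'n \<Rightarrow> 'a set" assume \<E>: "is_Nset \<Omega> \<E>"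
    show "H_const \<Phi> \<Omega> \<le> L_value \<Phi> \<E>"
    \<comment> \<open>With some infinite Cheeger constant the objective is infinite by convention;
      otherwise every chamber contains a Cheeger set of its own.\<close>
    proof (cases "\<forall>i. cheeger_const (\<E> i) < \<infinity>")
      case True
      have sub: "ae_subset A C" if "ae_subset A B" "ae_subset B C" for A B C :: "'a set"
      proof -
        have "(A - B) \<union> (B - C) \<in> null_sets lebesgue"
          using that by (simp add: ae_subset_def null_sets.Un)
        then show ?thesis unfolding ae_subset_def
          by (rule null_sets_completion_subset[rotated]) auto
      qed
      have \<E>s: "\<E> i \<in> sets lebesgue" "ae_subset (\<E> i) \<Omega>" for i using \<E> by (auto simp: is_Nset_def)
      have "\<exists>C. C \<in> sets lebesgue \<and> ae_subset C (\<E> i) \<and> vol C > 0 \<and> perimeter C < \<infinity>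
          \<and> perimeter C / ereal (vol C) = cheeger_const (\<E> i)" for i
        by (rule ex_Cheeger_set[OF \<E>s(1) sub[OF \<E>s(2) \<Omega>R] True[rule_format]]) (intro exI conjI)
      then have "\<exists>C. \<forall>i. C i \<in> sets lebesgue \<and> ae_subset (C i) (\<E> i) \<and> vol (C i) > 0
          \<and> perimeter (C i) < \<infinity> \<and> perimeter (C i) / ereal (vol (C i)) = cheeger_const (\<E> i)"
        by (intro choice allI)
      then obtain C where sC: "\<forall>i. C i \<in> sets lebesgue \<and> ae_subset (C i) (\<E> i) \<and> vol (C i) > 0
          \<and> perimeter (C i) < \<infinity> \<and> perimeter (C i) / ereal (vol (C i)) = cheeger_const (\<E> i)" ..
      have C: "C i \<in> sets lebesgue" "ae_subset (C i) (\<E> i)" "vol (C i) > 0" "perimeter (C i) < \<infinity>"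
        "perimeter (C i) / ereal (vol (C i)) = cheeger_const (\<E> i)" for i
        using sC[rule_format, of i] by simp_all
      have "is_Ncluster \<Omega> C"
        unfolding is_Ncluster_def is_Nset_def
      proof (intro conjI allI impI C)
        show "ae_subset (C i) \<Omega>" for i by (rule sub[OF C(2) \<E>s(2)])
        fix i j :: 'n assume "i \<noteq> j"
        then have "(C i - \<E> i) \<union> (C j - \<E> j) \<union> (\<E> i \<inter> \<E> j) \<in> null_sets lebesgue"
          using C(2) \<E> by (intro null_sets.Un) (auto simp: ae_subset_def is_Nset_def)
        then show "C i \<inter> C j \<in> null_sets lebesgue"
          by (rule null_sets_completion_subset[rotated]) auto
      qed
      \<comment> \<open>Attainment makes this an equality, so the two objectives coincide without
        any appeal to continuity of \<Phi>.\<close>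
      moreover have "real_of_ereal (cheeger_const (\<E> i)) = ratio C $ i" for i
        unfolding C(5)[symmetric] using C(4)[of i]
        by (elim perimeter_finite_real) (use C(3)[of i] in \<open>simp add: ratio_def\<close>)
      then have "L_value \<Phi> \<E> = ereal (H_value \<Phi> C)"
        using True by (simp add: L_value_def HV ratio_def)
      ultimately show ?thesis using H_le by simp
    next
      case False
      then have "L_value \<Phi> \<E> = \<infinity>" unfolding L_value_def by (rule if_not_P)
      then show ?thesis by simp
    qed
  qed
  moreover have "L_const \<Phi> \<Omega> \<le> L_value \<Phi> L"
    unfolding L_const_def by (rule INF_lower) (use L(1) in \<open>simp add: is_Ncluster_def\<close>)
  \<comment> \<open>The chain closes: \<open>L_const\<close> \<le> \<open>L_value\<close> of
    \<open>L\<close> \<le> \<open>H_value\<close> of \<open>L\<close> = \<open>H_const\<close> \<le>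
    \<open>L_const\<close>.\<close>
  ultimately have "L_value \<Phi> L = L_const \<Phi> \<Omega>" using HL by simp
  with L(1) HL show ?thesis by blast
qed

end
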